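(* Let $v\in F_S$, and consider the set $$[0,M(v)]:=\{M(w)\in\mathcal P_S\mid M(w)\subseteq M(v)\},$$ partially ordered by inclusion. Then the minimal nonzero elements of $[0,M(v)]$ are precisely the irreducible $U_q(\mathfrak l_S)$-submodules of $M(v)$ of the form $M(w)$ with $w\in F_S$.
   Context: Let $\mathfrak g$ be a complex semisimple Lie algebra with simple roots $\alpha_1,\dots,\alpha_r$, fundamental weights $\varpi_1,\dots,\varpi_r$, root lattice $Q$, integral weight lattice $P$, and Cartan matrix $(a_{ij})$. Let $\langle\cdot,\cdot\rangle$ be the bilinear pairing on $P\times P$ with $\langle \varpi_i,\alpha_j\rangle=\delta_{ij}d_i$ and $\langle\alpha_i,\alpha_j\rangle=d_ia_{ij}$, where the $d_i$ are positive integers symmetrizing the Cartan matrix. Let $k$ be a ground field of characteristic $0$ and $q\in k^\times$ not a root of unity; put $q_i=q^{d_i}$. $U_q(\mathfrak g)$ is the quantized enveloping algebra over $k$ with generators $E_i,F_i,K_i^{\pm1}$ ($1\le i\le r$) and relations: the $K_i$ are invertible and commute, $K_iE_jK_i^{-1}=q^{\langle\alpha_i,\alpha_j\rangle}E_j$, $K_iF_jK_i^{-1}=q^{-\langle\alpha_i,\alpha_j\rangle}F_j$, $E_iF_j-F_jE_i=\delta_{ij}(K_i-K_i^{-1})/(q_i-q_i^{-1})$, and the quantum Serre relations. It is a Hopf algebra with $\Delta(E_i)=E_i\otimes1+K_i\otimes E_i$, $\Delta(F_i)=F_i\otimes K_i^{-1}+1\otimes F_i$, $\Delta(K_i)=K_i\otimes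 K_i$, and antipode $S(E_i)=-K_i^{-1}E_i$, $S(F_i)=-F_iK_i$, $S(K_i)=K_i^{-1}$. The left adjoint action is $\operatorname{ad}_L(a)(b)=a_{(1)}\,b\,S(a_{(2)})$ (Sweedler notation). Fix a subset $S\subseteq\{1,\dots,r\}$ (same letter as the antipode, no confusion intended). The quantum Levi subalgebra $U_q(\mathfrak l_S)$ is the Hopf subalgebra generated by $E_i,F_i$ ($i\in S$) and $K_j^{\pm1}$ ($j=1,\dots,r$). It acts on $U_q(\mathfrak g)$ by $\operatorname{ad}_L$. Set $F_S=\{v\in U_q(\mathfrak g)\mid \dim \operatorname{ad}_L(U_q(\mathfrak l_S))\cdot v<\infty\}$ and, for $v\in F_S$, $M(v)=\operatorname{ad}_L(U_q(\mathfrak l_S))\cdot v=\{\operatorname{ad}_L(a)(v)\mid a\in U_q(\mathfrak l_S)\}$. Let $\mathcal P_S=\{M(v)\mid v\in F_S\}$, partially ordered by inclusion. Irreducible modules are nonzero by definition. *)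

theory Defs
  imports
    "HOL-Library.Poly_Mapping"
    "HOL-Library.Product_Plus"
    "HOL-Algebra.Embedded_Algebras"
    "HOL-Algebra.QuotRing"
    "HOL-Algebra.Algebraic_Closure_Type"
begin

section \<open>Cartan data\<close>

text \<open>
  A complex semisimple Lie algebra enters \<open>U\<^sub>q(\<gg>)\<close> only through its Cartan matrix and the
  chosen symmetrizers \<open>d\<close>. The Cartan matrices of complex semisimple Lie algebras are exactly the
  generalized Cartan matrices of finite type, i.e. those whose symmetrization is positive definite.
  The finite index type \<open>'i\<close> plays the role of \<open>{1, \<dots>, r}\<close>.
\<close>

definition semisimple_cartan :: "('i::finite \<Rightarrow> 'i \<Rightarrow> int) \<Rightarrow> ('i \<Rightarrow> nat) \<Rightarrow> bool" where
  "semisimple_cartan A d \<longleftrightarrow>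
     (\<forall>i. A i i = 2) \<and>
     (\<forall>i j. i \<noteq> j \<longrightarrow> A i j \<le> 0) \<and>
     (\<forall>i j. A i j = 0 \<longleftrightarrow> A j i = 0) \<and>
     (\<forall>i. 0 < d i) \<and>
     (\<forall>i j. int (d i) * A i j = int (d j) * A j i) \<and>
     (\<forall>x :: 'i \<Rightarrow> real. (\<exists>i. x i \<noteq> 0) \<longrightarrow>
        0 < (\<Sum>i\<in>UNIV. \<Sum>j\<in>UNIV. real (d i) * real_of_int (A i j) * x i * x j))"

definition root_pairing :: "('i \<Rightarrow> 'i \<Rightarrow> int) \<Rightarrow> ('i \<Rightarrow> nat) \<Rightarrow> 'i \<Rightarrow> 'i \<Rightarrow> int" where
  "root_pairing A d i j = int (d i) * A i j"

definition q_int :: "'k::field \<Rightarrow> nat \<Rightarrow> 'k" where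
  "q_int p n = (p ^ n - inverse p ^ n) / (p - inverse p)"

definition q_fact :: "'k::field \<Rightarrow> nat \<Rightarrow> 'k" where
  "q_fact p n = (\<Prod>m=1..n. q_int p m)"

definition q_binom :: "'k::field \<Rightarrow> nat \<Rightarrow> nat \<Rightarrow> 'k" where
  "q_binom p n s = q_fact p n / (q_fact p s * q_fact p (n - s))"


section \<open>Free algebras and their tensor squares\<close>

datatype 'a word = Word (letters: "'a list")

instantiation word :: (type) monoid_add
begin

definition zero_word :: "'a word" where
  "0 = Word []"

definition plus_word :: "'a word \<Rightarrow> 'a word \<Rightarrow> 'a word" where
  "u + v = Word (letters u @ letters v)"

instance
  by standard (simp_all add: zero_word_def plus_word_def)

end

text \<open>
  The algebra \<open>k[M]\<close> of a monoid \<open>M\<close>, written additively, is \<open>M \<Rightarrow>\<^sub>0 k\<close> with convolution as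
  multiplication. For \<open>M\<close> the free monoid this is the free algebra \<open>T\<close>; since
  \<open>k[M] \<otimes> k[M] = k[M \<times> M]\<close>, the algebra \<open>T \<otimes> T\<close> is \<open>M \<times> M \<Rightarrow>\<^sub>0 k\<close>.
\<close>

datatype 'i gen = GenE 'i | GenF 'i | GenK 'i | GenKinv 'i

type_synonym ('i, 'k) free_alg = "'i gen word \<Rightarrow>\<^sub>0 'k"
type_synonym ('i, 'k) free_alg2 = "'i gen word \<times> 'i gen word \<Rightarrow>\<^sub>0 'k"

definition scal :: "'k::field \<Rightarrow> ('m::monoid_add \<Rightarrow>\<^sub>0 'k)" where
  "scal c = Poly_Mapping.single 0 c"

definition gen :: "'i gen \<Rightarrow> ('i, 'k::field) free_alg" where
  "gen x = Poly_Mapping.single (Word [x]) 1"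

abbreviation "tE i \<equiv> gen (GenE i)"
abbreviation "tF i \<equiv> gen (GenF i)"
abbreviation "tK i \<equiv> gen (GenK i)"
abbreviation "tKi i \<equiv> gen (GenKinv i)"

definition lin_ext :: "('b \<Rightarrow> ('m::monoid_add \<Rightarrow>\<^sub>0 'k)) \<Rightarrow> ('b \<Rightarrow>\<^sub>0 'k::field) \<Rightarrow> ('m \<Rightarrow>\<^sub>0 'k)" where
  "lin_ext f p = (\<Sum>b\<in>Poly_Mapping.keys p. scal (Poly_Mapping.lookup p b) * f b)"

definition alg_ext ::
    "('i gen \<Rightarrow> ('m::monoid_add \<Rightarrow>\<^sub>0 'k)) \<Rightarrow> ('i, 'k::field) free_alg \<Rightarrow> ('m \<Rightarrow>\<^sub>0 'k)" where
  "alg_ext f = lin_ext (\<lambda>w. prod_list (map f (letters w)))"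

definition antialg_ext ::
    "('i gen \<Rightarrow> ('m::monoid_add \<Rightarrow>\<^sub>0 'k)) \<Rightarrow> ('i, 'k::field) free_alg \<Rightarrow> ('m \<Rightarrow>\<^sub>0 'k)" where
  "antialg_ext f = lin_ext (\<lambda>w. prod_list (map f (rev (letters w))))"

definition free_tensor ::
    "('i, 'k::field) free_alg \<Rightarrow> ('i, 'k) free_alg \<Rightarrow> ('i, 'k) free_alg2" where
  "free_tensor p p' =
     (\<Sum>u\<in>Poly_Mapping.keys p. \<Sum>v\<in>Poly_Mapping.keys p'.
        Poly_Mapping.single (u, v) (Poly_Mapping.lookup p u * Poly_Mapping.lookup p' v))"

text \<open>Values of the comultiplication and the antipode on the generators, in \<open>T \<otimes> T\<close> and \<open>T\<close>.\<close>

fun comult_gen :: "'i gen \<Rightarrow> ('i, 'k::field) free_alg2" where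
  "comult_gen (GenE i) = free_tensor (tE i) 1 + free_tensor (tK i) (tE i)"
| "comult_gen (GenF i) = free_tensor (tF i) (tKi i) + free_tensor 1 (tF i)"
| "comult_gen (GenK i) = free_tensor (tK i) (tK i)"
| "comult_gen (GenKinv i) = free_tensor (tKi i) (tKi i)"

fun antipode_gen :: "'i gen \<Rightarrow> ('i, 'k::field) free_alg" where
  "antipode_gen (GenE i) = - (tKi i * tE i)"
| "antipode_gen (GenF i) = - (tF i * tK i)"
| "antipode_gen (GenK i) = tKi i"
| "antipode_gen (GenKinv i) = tK i"


section \<open>The quantized enveloping algebra\<close>

abbreviation free_ring :: "('i, 'k::field) free_alg ring" where
  "free_ring \<equiv> ring_of_type_algebra"

text \<open>Each relation \<open>x = y\<close> is recorded as the element \<open>x - y\<close> of the free algebra.\<close>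

inductive_set Uq_relations ::
    "('i \<Rightarrow> 'i \<Rightarrow> int) \<Rightarrow> ('i \<Rightarrow> nat) \<Rightarrow> 'k::field \<Rightarrow> ('i, 'k) free_alg set"
  for A :: "'i \<Rightarrow> 'i \<Rightarrow> int" and d :: "'i \<Rightarrow> nat" and q :: "'k::field"
where
  K_Kinv: "tK i * tKi i - 1 \<in> Uq_relations A d q"
| Kinv_K: "tKi i * tK i - 1 \<in> Uq_relations A d q"
| K_K: "tK i * tK j - tK j * tK i \<in> Uq_relations A d q"
| K_E: "tK i * tE j * tKi i - scal (q powi root_pairing A d i j) * tE j \<in> Uq_relations A d q"
| K_F: "tK i * tF j * tKi i - scal (q powi (- root_pairing A d i j)) * tF j \<in> Uq_relations A d q"
| E_F: "tE i * tF j - tF j * tE i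
          - (if i = j then scal (1 / (q ^ d i - inverse (q ^ d i))) * (tK i - tKi i) else 0)
        \<in> Uq_relations A d q"
| Serre_E: "i \<noteq> j \<Longrightarrow>
     (\<Sum>s\<le>nat (1 - A i j). scal ((- 1) ^ s * q_binom (q ^ d i) (nat (1 - A i j)) s)
        * tE i ^ (nat (1 - A i j) - s) * tE j * tE i ^ s) \<in> Uq_relations A d q"
| Serre_F: "i \<noteq> j \<Longrightarrow>
     (\<Sum>s\<le>nat (1 - A i j). scal ((- 1) ^ s * q_binom (q ^ d i) (nat (1 - A i j)) s)
        * tF i ^ (nat (1 - A i j) - s) * tF j * tF i ^ s) \<in> Uq_relations A d q"

context
  fixes A :: "'i::finite \<Rightarrow> 'i \<Rightarrow> int" and d :: "'i \<Rightarrow> nat" and q :: "'k::field"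
begin

definition Uq_ideal :: "('i, 'k) free_alg set" where
  "Uq_ideal = Idl\<^bsub>free_ring\<^esub> (Uq_relations A d q)"

definition Uq :: "('i, 'k) free_alg set ring" where
  "Uq = free_ring Quot Uq_ideal"

definition Uq_class :: "('i, 'k) free_alg \<Rightarrow> ('i, 'k) free_alg set" where
  "Uq_class p = Uq_ideal +>\<^bsub>free_ring\<^esub> p"

text \<open>
  The ground field inside \<open>U\<^sub>q(\<gg>)\<close>; vector space notions over \<open>k\<close> are those of
  \<^theory>\<open>HOL-Algebra.Embedded_Algebras\<close> over this subfield.
\<close>

definition Uq_field :: "('i, 'k) free_alg set set" where
  "Uq_field = range (\<lambda>c. Uq_class (scal c))"


subsection \<open>Hopf structure\<close>

text \<open>
  With \<open>U = T / I\<close>, the tensor square \<open>U \<otimes> U\<close> is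
  \<open>(T \<otimes> T) / (I \<otimes> T + T \<otimes> I)\<close>.
\<close>

definition Uq2_ideal :: "('i, 'k) free_alg2 set" where
  "Uq2_ideal = Idl\<^bsub>ring_of_type_algebra\<^esub>
     ({free_tensor p 1 | p. p \<in> Uq_ideal} \<union> {free_tensor 1 p | p. p \<in> Uq_ideal})"

definition Uq2 :: "('i, 'k) free_alg2 set ring" where
  "Uq2 = ring_of_type_algebra Quot Uq2_ideal"

definition Uq_tensor ::
    "('i, 'k) free_alg set \<Rightarrow> ('i, 'k) free_alg set \<Rightarrow> ('i, 'k) free_alg2 set" where
  "Uq_tensor x y = (\<Union>p\<in>x. \<Union>p'\<in>y. Uq2_ideal +>\<^bsub>ring_of_type_algebra\<^esub> free_tensor p p')"

text \<open>
  As with \<^const>\<open>rcoset_mult\<close>, maps induced on cosets are written as unions over all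
  representatives.
\<close>

definition Uq_comult :: "('i, 'k) free_alg set \<Rightarrow> ('i, 'k) free_alg2 set" where
  "Uq_comult x = (\<Union>p\<in>x. Uq2_ideal +>\<^bsub>ring_of_type_algebra\<^esub> alg_ext comult_gen p)"

definition Uq_antipode :: "('i, 'k) free_alg set \<Rightarrow> ('i, 'k) free_alg set" where
  "Uq_antipode x = (\<Union>p\<in>x. Uq_class (antialg_ext antipode_gen p))"

definition Uq_hopf_subalgebra :: "('i, 'k) free_alg set set \<Rightarrow> bool" where
  "Uq_hopf_subalgebra H \<longleftrightarrow>
     subring H Uq \<and> subalgebra Uq_field H Uq \<and>
     (\<forall>x\<in>H. Uq_comult x \<in> generate (add_monoid Uq2) {Uq_tensor y z | y z. y \<in> H \<and> z \<in> H}) \<and>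
     (\<forall>x\<in>H. Uq_antipode x \<in> H)"

definition Uq_levi :: "'i set \<Rightarrow> ('i, 'k) free_alg set set" where
  "Uq_levi S = \<Inter>{H. Uq_hopf_subalgebra H \<and>
     (\<forall>i\<in>S. Uq_class (tE i) \<in> H \<and> Uq_class (tF i) \<in> H) \<and>
     (\<forall>j. Uq_class (tK j) \<in> H \<and> Uq_class (tKi j) \<in> H)}"


subsection \<open>The adjoint action\<close>

text \<open>
  \<open>\<Delta>(a) = \<Sum>\<^sub>m x\<^sub>m \<otimes> y\<^sub>m\<close> gives \<open>ad\<^sub>L(a)(b) = \<Sum>\<^sub>m x\<^sub>m b S(y\<^sub>m)\<close>, which does not depend on how
  \<open>\<Delta>(a)\<close> is written.
\<close>

definition ad_L ::
    "('i, 'k) free_alg set \<Rightarrow> ('i, 'k) free_alg set \<Rightarrow> ('i, 'k) free_alg set" where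
  "ad_L a b = (THE z. \<exists>(n::nat) x y.
     x \<in> {..<n} \<rightarrow> carrier Uq \<and> y \<in> {..<n} \<rightarrow> carrier Uq \<and>
     Uq_comult a = (\<Oplus>\<^bsub>Uq2\<^esub>m\<in>{..<n}. Uq_tensor (x m) (y m)) \<and>
     z = (\<Oplus>\<^bsub>Uq\<^esub>m\<in>{..<n}. x m \<otimes>\<^bsub>Uq\<^esub> b \<otimes>\<^bsub>Uq\<^esub> Uq_antipode (y m)))"

context
  fixes S :: "'i set"
begin

definition ad_orbit :: "('i, 'k) free_alg set \<Rightarrow> ('i, 'k) free_alg set set" where
  "ad_orbit v = {ad_L a v | a. a \<in> Uq_levi S}"

definition locally_finite_part :: "('i, 'k) free_alg set set" where
  "locally_finite_part =
     {v \<in> carrier Uq. ring.finite_dimension Uq Uq_field (ad_orbit v)}"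

definition orbit_poset :: "('i, 'k) free_alg set set set" where
  "orbit_poset = ad_orbit ` locally_finite_part"

definition orbit_interval :: "('i, 'k) free_alg set \<Rightarrow> ('i, 'k) free_alg set set set" where
  "orbit_interval v = {N \<in> orbit_poset. N \<subseteq> ad_orbit v}"

definition levi_submodule ::
    "('i, 'k) free_alg set set \<Rightarrow> ('i, 'k) free_alg set set \<Rightarrow> bool" where
  "levi_submodule N M \<longleftrightarrow>
     N \<subseteq> M \<and> subalgebra Uq_field N Uq \<and> (\<forall>a\<in>Uq_levi S. \<forall>x\<in>N. ad_L a x \<in> N)"

definition levi_irreducible :: "('i, 'k) free_alg set set \<Rightarrow> bool" where
  "levi_irreducible N \<longleftrightarrow>
     levi_submodule N (carrier Uq) \<and> N \<noteq> {\<zero>\<^bsub>Uq\<^esub>} \<and>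
     (\<forall>N'. levi_submodule N' N \<longrightarrow> N' = {\<zero>\<^bsub>Uq\<^esub>} \<or> N' = N)"

definition minimal_nonzero ::
    "('i, 'k) free_alg set set set \<Rightarrow> ('i, 'k) free_alg set set set" where
  "minimal_nonzero Ns =
     {N \<in> Ns. N \<noteq> {\<zero>\<^bsub>Uq\<^esub>} \<and> (\<forall>N'\<in>Ns. N' \<noteq> {\<zero>\<^bsub>Uq\<^esub>} \<and> N' \<subseteq> N \<longrightarrow> N' = N)}"

end

end

end

theory Submission
  imports Defs
begin

text \<open>
  Once the left adjoint action is known to be a representation of \<open>U\<^sub>q(\<ll>\<^sub>S)\<close>, every \<open>M(w)\<close> is
  a submodule, it is the least one containing \<open>w\<close>, and a nonzero element \<open>x\<close> of a finite-dimensional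
  \<open>M(w)\<close> generates a finite-dimensional \<open>M(x) \<subseteq> M(w)\<close>. Hence a minimal \<open>M(w)\<close> is generated by each of
  its nonzero elements, so it is irreducible, and the converse is immediate.

  The substance is that the comultiplication and the antipode, given on generators, respect the
  defining relations. For the quantum Serre relations, the \<open>q\<close>-binomial theorem writes
  \<open>\<Sum>\<^sub>s (-1)\<^sup>s [n,s] x\<^bsup>n-s\<^esup> z x\<^sup>s\<close> as an iterated skew commutator, in which each summand of
  \<open>\<Delta>(E\<^sub>i)\<close> either acts as the original generator or skew commutes away.
\<close>

section \<open>Congruences modulo two-sided ideals\<close>

text \<open>\<open>ad_L\<close> is a definite description over all ways of writing a coproduct, and
  the Hopf maps are unions over all representatives, so nothing can be said about the action before
  well-definedness. All computation is therefore done on representatives, in the free algebra T and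
  in T (x) T, by congruences modulo the two ideals.

  Why the skew commutator works: for p = q_i, c = a_ij and n = 1 - c, the Serre sum is the product
  of the commuting operators z -> x z - g z x, where g runs through p^c, p^(c+2), ..., p^(-c). This
  list is closed under inversion, so it may be read upwards or downwards. Write the coproduct of E_i
  as x + y with y x = p^2 x y. Read upwards, each g is exactly the factor that y acquires when it
  passes the commutator built so far, so y cancels at every step; read downwards from the other
  summand of the coproduct of E_j, x cancels in the same way.

  Why ad is a representation: it factors through the linear map x (x) y -> x b S(y) on T (x) T.
  Independence of choices is then the statement that this map sends one ideal into the other, and
  the action law is multiplicativity of \<Delta> combined with antimultiplicativity of S.\<close>

definition two_sided :: "'a::ring_1 set \<Rightarrow> bool" where
  "two_sided J \<longleftrightarrow> 0 \<in> J \<and> (\<forall>x\<in>J. \<forall>y\<in>J. x + y \<in> J) \<and> (\<forall>x\<in>J. \<forall>r. r * x \<in> J \<and> x * r \<in> J)"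

definition idcong :: "'a::ring_1 \<Rightarrow> 'a set \<Rightarrow> 'a \<Rightarrow> bool" ("(_ \<approx>\<^bsub>_\<^esub> _)" [51, 0, 51] 50) where
  "x \<approx>\<^bsub>J\<^esub> y \<longleftrightarrow> x - y \<in> J"

lemma two_sided_uminus: "two_sided J \<Longrightarrow> x \<in> J \<Longrightarrow> - x \<in> J"
  unfolding two_sided_def by (metis mult_minus1)

lemma two_sided_add: "two_sided J \<Longrightarrow> x \<in> J \<Longrightarrow> y \<in> J \<Longrightarrow> x + y \<in> J"
  unfolding two_sided_def by blast

lemma two_sided_diff: "two_sided J \<Longrightarrow> x \<in> J \<Longrightarrow> y \<in> J \<Longrightarrow> x - y \<in> J"
  using two_sided_add[of J x "- y"] two_sided_uminus[of J y] by simp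

lemma two_sided_mult_left: "two_sided J \<Longrightarrow> x \<in> J \<Longrightarrow> r * x \<in> J"
  unfolding two_sided_def by blast

lemma two_sided_mult_right: "two_sided J \<Longrightarrow> x \<in> J \<Longrightarrow> x * r \<in> J"
  unfolding two_sided_def by blast

lemma two_sided_sum: "two_sided J \<Longrightarrow> (\<And>i. i \<in> B \<Longrightarrow> f i \<in> J) \<Longrightarrow> sum f B \<in> J"
  by (induction B rule: infinite_finite_induct) (auto simp: two_sided_def)

lemma idcong_refl: "two_sided J \<Longrightarrow> x \<approx>\<^bsub>J\<^esub> x"
  by (simp add: idcong_def two_sided_def)

lemma idcong_sym: "two_sided J \<Longrightarrow> x \<approx>\<^bsub>J\<^esub> y \<Longrightarrow> y \<approx>\<^bsub>J\<^esub> x"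
  unfolding idcong_def using two_sided_uminus by fastforce

lemma idcong_trans: "two_sided J \<Longrightarrow> x \<approx>\<^bsub>J\<^esub> y \<Longrightarrow> y \<approx>\<^bsub>J\<^esub> z \<Longrightarrow> x \<approx>\<^bsub>J\<^esub> z"
  unfolding idcong_def using two_sided_add by fastforce

lemma idcong_add:
  assumes "two_sided J" "x \<approx>\<^bsub>J\<^esub> x'" "y \<approx>\<^bsub>J\<^esub> y'"
  shows "x + y \<approx>\<^bsub>J\<^esub> x' + y'"
  using two_sided_add[OF assms(1) assms(2,3)[unfolded idcong_def]]
  by (simp add: idcong_def algebra_simps)

lemma idcong_diff:
  assumes "two_sided J" "x \<approx>\<^bsub>J\<^esub> x'" "y \<approx>\<^bsub>J\<^esub> y'"
  shows "x - y \<approx>\<^bsub>J\<^esub> x' - y'"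
  using two_sided_diff[OF assms(1) assms(2,3)[unfolded idcong_def]]
  by (simp add: idcong_def algebra_simps)

lemma idcong_mult:
  assumes J: "two_sided J" and x: "x \<approx>\<^bsub>J\<^esub> x'" and y: "y \<approx>\<^bsub>J\<^esub> y'"
  shows "x * y \<approx>\<^bsub>J\<^esub> x' * y'"
proof -
  have "(x - x') * y + x' * (y - y') \<in> J"
    using J x y unfolding idcong_def
    by (intro two_sided_add two_sided_mult_left two_sided_mult_right)
  then show ?thesis by (simp add: idcong_def algebra_simps)
qed

lemma idcong_mem: "two_sided J \<Longrightarrow> x \<approx>\<^bsub>J\<^esub> y \<Longrightarrow> y \<in> J \<Longrightarrow> x \<in> J"
  unfolding idcong_def using two_sided_add[of J "x - y" y] by simp

text \<open>The bridge that lets membership be argued with type class arithmetic while generated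
  ideals and cosets come from HOL-Algebra.\<close>

lemma two_sided_iff_ideal: "two_sided J \<longleftrightarrow> ideal J (ring_of_type_algebra :: 'a::ring_1 ring)"
  (is "_ \<longleftrightarrow> ideal J ?R")
proof -
  have R: "ring ?R"
  proof -
    have "\<exists>y. x + y = 0" for x :: 'a
      using add.right_inverse by blast
    then show ?thesis
      unfolding ring_of_type_algebra_def using add.right_inverse
      by unfold_locales (auto simp: algebra_simps Units_def)
  qed
  interpret ring ?R by (rule R)
  show ?thesis
  proof
    assume J: "two_sided J"
    have inv: "\<ominus>\<^bsub>?R\<^esub> a = - a" for a
      using minus_equality[of "- a" a] by (simp add: ring_of_type_algebra_def)
    show "ideal J ?R"
    proof (rule idealI[OF R])
      show "subgroup J (add_monoid ?R)"
        using J two_sided_uminus[OF J] inv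
        by (intro add.subgroupI) (auto simp: two_sided_def inv, auto simp: ring_of_type_algebra_def)
    qed (use J in \<open>auto simp: two_sided_def ring_of_type_algebra_def\<close>)
  next
    assume "ideal J ?R"
    then interpret ideal J ?R .
    show "two_sided J"
      unfolding two_sided_def
      using zero_closed a_closed I_l_closed I_r_closed
      by (auto simp: ring_of_type_algebra_def)
  qed
qed

lemma ring_ring_of_type_algebra: "ring (ring_of_type_algebra :: 'a::ring_1 ring)"
proof -
  \<comment> \<open>The unit ideal is enough, because \<open>ideal\<close> carries the ring axioms
    of the ambient structure.\<close>
  have "two_sided (UNIV :: 'a set)" by (simp add: two_sided_def)
  then show ?thesis using two_sided_iff_ideal ideal.axioms(2) by blast
qed

lemma ring_of_type_algebra_simps [simp]:
  "carrier ring_of_type_algebra = UNIV"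
  "x \<oplus>\<^bsub>ring_of_type_algebra\<^esub> y = x + y" "x \<otimes>\<^bsub>ring_of_type_algebra\<^esub> y = x * y"
  "\<one>\<^bsub>ring_of_type_algebra\<^esub> = 1" "\<zero>\<^bsub>ring_of_type_algebra\<^esub> = 0"
  by (simp_all add: ring_of_type_algebra_def)

lemma a_minus_ring_of_type_algebra [simp]:
  "x \<ominus>\<^bsub>ring_of_type_algebra\<^esub> y = x - (y :: 'a::ring_1)"
proof -
  interpret ring "ring_of_type_algebra :: 'a ring" by (rule ring_ring_of_type_algebra)
  have "\<ominus>\<^bsub>ring_of_type_algebra\<^esub> y = - y"
    using minus_equality[of "- y" y] by simp
  then show ?thesis by (simp add: a_minus_def)
qed

lemma two_sided_Idl: "two_sided (Idl\<^bsub>ring_of_type_algebra\<^esub> B)"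
  by (simp add: two_sided_iff_ideal ring.genideal_ideal[OF ring_ring_of_type_algebra])

lemma Idl_superset: "x \<in> B \<Longrightarrow> x \<in> Idl\<^bsub>ring_of_type_algebra\<^esub> B"
  using ring.genideal_self[OF ring_ring_of_type_algebra, of B] by auto

lemma Idl_minimal: "two_sided J \<Longrightarrow> B \<subseteq> J \<Longrightarrow> Idl\<^bsub>ring_of_type_algebra\<^esub> B \<subseteq> J"
  using ring.genideal_minimal[OF ring_ring_of_type_algebra] by (simp add: two_sided_iff_ideal)

lemma coset_eq_iff:
  assumes "two_sided J"
  shows "J +>\<^bsub>ring_of_type_algebra\<^esub> x = J +>\<^bsub>ring_of_type_algebra\<^esub> y \<longleftrightarrow> x \<approx>\<^bsub>J\<^esub> y"
  using ring.quotient_eq_iff_same_a_r_cos[OF ring_ring_of_type_algebra, of J x y] assms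
  by (auto simp: two_sided_iff_ideal idcong_def)


section \<open>Scalars and linear extensions\<close>

text \<open>Kept apart from the product so that, scalars being central, simplification moves every
  coefficient to the front and merges coefficients there.\<close>

definition smul :: "'k::field \<Rightarrow> ('m::monoid_add \<Rightarrow>\<^sub>0 'k) \<Rightarrow> ('m \<Rightarrow>\<^sub>0 'k)" (infixr "\<odot>" 75) where
  "c \<odot> x = scal c * x"

text \<open>Reduces identities between linear maps to monomials. The monomial case includes the
  coefficient 0 and thereby covers the zero polynomial.\<close>

lemma poly_mapping_single_induct [case_names single add]:
  assumes s: "\<And>m c. P (Poly_Mapping.single m c)" and a: "\<And>p q. P p \<Longrightarrow> P q \<Longrightarrow> P (p + q)"
  shows "P (p :: 'm \<Rightarrow>\<^sub>0 'k::comm_monoid_add)"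
proof (induction p rule: update_induct)
  case const
  then show ?case using s[of undefined 0] by simp
next
  case (update f a b)
  have "Poly_Mapping.update a b f = f + Poly_Mapping.single a b"
    using update.hyps
    by (intro poly_mapping_eqI)
       (auto simp: lookup_update lookup_add lookup_single not_in_keys_iff_lookup_eq_zero when_def)
  then show ?case using a s update by simp
qed

lemma scal_add: "scal (a + b) = scal a + scal b"
  by (simp add: scal_def single_add)

lemma scal_mult: "scal (a * b) = scal a * scal b"
  by (simp add: scal_def mult_single)

lemma scal_1 [simp]: "scal 1 = 1"
  by (simp add: scal_def)

lemma scal_0 [simp]: "scal 0 = 0"
  by (simp add: scal_def)

lemma scal_uminus: "scal (- a) = - scal a"
  by (simp add: scal_def single_uminus)

lemma scal_comm: "x * scal c = scal c * (x :: 'm::monoid_add \<Rightarrow>\<^sub>0 'k::field)"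
proof (induction x rule: poly_mapping_single_induct)
  case (single m c)
  then show ?case by (simp add: scal_def mult_single mult.commute)
next
  case (add p q)
  then show ?case by (simp add: algebra_simps)
qed

lemma smul_1 [simp]: "1 \<odot> x = x"
  by (simp add: smul_def)

lemma smul_0_left [simp]: "0 \<odot> x = 0"
  by (simp add: smul_def)

lemma smul_0_right [simp]: "c \<odot> 0 = 0"
  by (simp add: smul_def)

lemma smul_smul [simp]: "a \<odot> b \<odot> x = (a * b) \<odot> x"
  by (simp add: smul_def scal_mult mult.assoc)

lemma smul_mult_left [simp]: "(c \<odot> x) * y = c \<odot> (x * y)"
  by (simp add: smul_def mult.assoc)

lemma smul_mult_right [simp]: "x * (c \<odot> y) = c \<odot> (x * y)"
  unfolding smul_def by (metis mult.assoc scal_comm)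

lemma smul_add: "c \<odot> (x + y) = c \<odot> x + c \<odot> y"
  by (simp add: smul_def distrib_left)

lemma smul_diff: "c \<odot> (x - y) = c \<odot> x - c \<odot> y"
  by (simp add: smul_def right_diff_distrib)

lemma smul_add_left: "(a + b) \<odot> x = a \<odot> x + b \<odot> x"
  by (simp add: smul_def scal_add distrib_right)

lemma smul_uminus_left: "(- a) \<odot> x = - (a \<odot> x)"
  by (simp add: smul_def scal_uminus)

lemma smul_uminus_right: "a \<odot> (- x) = - (a \<odot> x)"
  by (simp add: smul_def)

lemma smul_diff_left: "(a - b) \<odot> x = a \<odot> x - b \<odot> x"
  using smul_add_left[of a "- b" x] by (simp add: smul_uminus_left)

lemma smul_sum: "c \<odot> sum f B = (\<Sum>b\<in>B. c \<odot> f b)"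
  by (simp add: smul_def sum_distrib_left)

lemma smul_single: "c \<odot> Poly_Mapping.single m a = Poly_Mapping.single m (c * a)"
  by (simp add: smul_def scal_def mult_single)

lemma idcong_smul: "two_sided J \<Longrightarrow> x \<approx>\<^bsub>J\<^esub> y \<Longrightarrow> c \<odot> x \<approx>\<^bsub>J\<^esub> c \<odot> y"
  unfolding smul_def by (intro idcong_mult idcong_refl)

lemma two_sided_smul: "two_sided J \<Longrightarrow> x \<in> J \<Longrightarrow> c \<odot> x \<in> J"
  unfolding smul_def by (rule two_sided_mult_left)

lemmas idcong_intros =
  idcong_refl idcong_add idcong_diff idcong_mult idcong_smul

text \<open>Cancellation makes the support of a sum unpredictable; over a common finite superset,
  additivity becomes a termwise statement.\<close>

lemma lin_ext_superset:
  assumes "finite B" "Poly_Mapping.keys p \<subseteq> B"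
  shows "lin_ext f p = (\<Sum>b\<in>B. Poly_Mapping.lookup p b \<odot> f b)"
  unfolding lin_ext_def smul_def
  using assms by (intro sum.mono_neutral_left) (auto simp: in_keys_iff)

lemma lin_ext_single [simp]: "lin_ext f (Poly_Mapping.single m c) = c \<odot> f m"
  using lin_ext_superset[of "{m}" "Poly_Mapping.single m c" f] by (simp split: if_splits)

lemma lin_ext_add: "lin_ext f (p + q) = lin_ext f p + lin_ext f q"
proof -
  let ?B = "Poly_Mapping.keys p \<union> Poly_Mapping.keys q"
  have "lin_ext f (p + q) = (\<Sum>b\<in>?B. Poly_Mapping.lookup (p + q) b \<odot> f b)"
    by (rule lin_ext_superset) (use keys_add[of p q] in auto)
  also have "\<dots> = lin_ext f p + lin_ext f q"
    using lin_ext_superset[of ?B p f] lin_ext_superset[of ?B q f]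
    by (simp add: lookup_add smul_add_left sum.distrib)
  finally show ?thesis .
qed

lemma lin_ext_smul: "lin_ext f (c \<odot> p) = c \<odot> lin_ext f p"
  by (induction p rule: poly_mapping_single_induct) (simp_all add: smul_single lin_ext_add smul_add)

lemma lin_ext_0 [simp]: "lin_ext f 0 = 0"
  by (simp add: lin_ext_def)

lemma lin_ext_uminus: "lin_ext f (- p) = - lin_ext f p"
  using lin_ext_add[of f p "- p"] by (simp add: eq_neg_iff_add_eq_0 add.commute)

lemma lin_ext_diff: "lin_ext f (p - q) = lin_ext f p - lin_ext f q"
  using lin_ext_add[of f p "- q"] by (simp add: lin_ext_uminus)

lemma lin_ext_sum: "lin_ext f (sum g B) = (\<Sum>b\<in>B. lin_ext f (g b))"
  by (induction B rule: infinite_finite_induct) (simp_all add: lin_ext_add)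

lemma letters_add [simp]: "letters (u + v) = letters u @ letters v"
  by (simp add: plus_word_def)

lemma letters_0 [simp]: "letters 0 = []"
  by (simp add: zero_word_def)

lemma one_eq_single: "1 = Poly_Mapping.single 0 1"
  by simp

lemma alg_ext_mult: "alg_ext f (p * r) = alg_ext f p * alg_ext f r"
proof (induction p rule: poly_mapping_single_induct)
  case (single m c)
  show ?case
    by (induction r rule: poly_mapping_single_induct)
       (simp_all add: alg_ext_def mult_single lin_ext_add distrib_left smul_add mult.commute)
qed (simp add: alg_ext_def lin_ext_add distrib_right)

lemma antialg_ext_mult: "antialg_ext f (p * r) = antialg_ext f r * antialg_ext f p"
proof (induction p rule: poly_mapping_single_induct)
  case (single m c)
  show ?case
    by (induction r rule: poly_mapping_single_induct)
       (simp_all add: antialg_ext_def mult_single lin_ext_add distrib_right distrib_left mult.commute smul_add)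
qed (simp add: antialg_ext_def lin_ext_add distrib_left distrib_right)

lemma alg_ext_1 [simp]: "alg_ext f 1 = 1"
  unfolding one_eq_single alg_ext_def lin_ext_single by simp

lemma antialg_ext_1 [simp]: "antialg_ext f 1 = 1"
  unfolding one_eq_single antialg_ext_def lin_ext_single by simp

lemma alg_ext_power: "alg_ext f (p ^ n) = alg_ext f p ^ n"
  by (induction n) (simp_all add: alg_ext_mult)

lemma antialg_ext_power: "antialg_ext f (p ^ n) = antialg_ext f p ^ n"
  by (induction n) (simp_all add: antialg_ext_mult power_commutes)

lemma alg_ext_gen [simp]: "alg_ext f (gen x) = f x"
  by (simp add: alg_ext_def gen_def)

lemma antialg_ext_gen [simp]: "antialg_ext f (gen x) = f x"
  by (simp add: antialg_ext_def gen_def)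

lemma alg_ext_add: "alg_ext f (p + r) = alg_ext f p + alg_ext f r"
  and alg_ext_diff: "alg_ext f (p - r) = alg_ext f p - alg_ext f r"
  and alg_ext_uminus: "alg_ext f (- p) = - alg_ext f p"
  and alg_ext_smul: "alg_ext f (c \<odot> p) = c \<odot> alg_ext f p"
  and alg_ext_0 [simp]: "alg_ext f 0 = 0"
  and alg_ext_sum: "alg_ext f (sum g B) = (\<Sum>b\<in>B. alg_ext f (g b))"
  by (simp_all add: alg_ext_def lin_ext_add lin_ext_diff lin_ext_uminus lin_ext_smul lin_ext_sum)

lemma antialg_ext_add: "antialg_ext f (p + r) = antialg_ext f p + antialg_ext f r"
  and antialg_ext_diff: "antialg_ext f (p - r) = antialg_ext f p - antialg_ext f r"
  and antialg_ext_smul: "antialg_ext f (c \<odot> p) = c \<odot> antialg_ext f p"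
  and antialg_ext_0 [simp]: "antialg_ext f 0 = 0"
  and antialg_ext_sum: "antialg_ext f (sum g B) = (\<Sum>b\<in>B. antialg_ext f (g b))"
  by (simp_all add: antialg_ext_def lin_ext_add lin_ext_diff lin_ext_smul lin_ext_sum)


section \<open>The tensor product of elements\<close>

lemma lookup_free_tensor:
  "Poly_Mapping.lookup (free_tensor p r) (u, v) = Poly_Mapping.lookup p u * Poly_Mapping.lookup r v"
proof -
  have "Poly_Mapping.lookup (free_tensor p r) (u, v) =
      (\<Sum>a\<in>Poly_Mapping.keys p. \<Sum>b\<in>Poly_Mapping.keys r.
        if a = u \<and> b = v then Poly_Mapping.lookup p a * Poly_Mapping.lookup r b else 0)"
    by (simp add: free_tensor_def lookup_sum lookup_single when_def)
  also have "\<dots> = (\<Sum>a\<in>Poly_Mapping.keys p. if a = u then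
        (\<Sum>b\<in>Poly_Mapping.keys r. if b = v then Poly_Mapping.lookup p a * Poly_Mapping.lookup r b else 0)
        else 0)"
    by (intro sum.cong) auto
  also have "\<dots> = Poly_Mapping.lookup p u * Poly_Mapping.lookup r v"
    by (auto simp: sum.delta in_keys_iff)
  finally show ?thesis .
qed

lemma free_tensor_single:
  "free_tensor (Poly_Mapping.single u a) (Poly_Mapping.single v b) = Poly_Mapping.single (u, v) (a * b)"
  by (intro poly_mapping_eqI) (auto simp: lookup_free_tensor lookup_single when_def split: if_splits)

lemma free_tensor_add_left: "free_tensor (p + p') r = free_tensor p r + free_tensor p' r"
  and free_tensor_add_right: "free_tensor p (r + r') = free_tensor p r + free_tensor p r'"
  and free_tensor_diff_left: "free_tensor (p - p') r = free_tensor p r - free_tensor p' r"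
  and free_tensor_diff_right: "free_tensor p (r - r') = free_tensor p r - free_tensor p r'"
  and free_tensor_0_left [simp]: "free_tensor 0 r = 0"
  and free_tensor_0_right [simp]: "free_tensor p 0 = 0"
  by (intro poly_mapping_eqI;
      auto simp: lookup_free_tensor lookup_add lookup_minus algebra_simps)+

lemma free_tensor_mult:
  "free_tensor p r * free_tensor p' r' = free_tensor (p * p') (r * r')"
proof (induction p rule: poly_mapping_single_induct)
  case (single m c)
  show ?case
  proof (induction r rule: poly_mapping_single_induct)
    case (single n e)
    show ?case
    proof (induction p' rule: poly_mapping_single_induct)
      case (single m' c')
      show ?case
        by (induction r' rule: poly_mapping_single_induct)
           (simp_all add: free_tensor_single mult_single algebra_simps free_tensor_add_right)
    qed (simp add: free_tensor_add_left algebra_simps)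
  qed (simp add: free_tensor_add_right algebra_simps)
qed (simp add: free_tensor_add_left algebra_simps)

lemma free_tensor_1_1 [simp]: "free_tensor 1 1 = 1"
  unfolding one_eq_single free_tensor_single by (simp add: zero_prod_def)

lemma lookup_smul [simp]: "Poly_Mapping.lookup (c \<odot> p) m = c * Poly_Mapping.lookup p m"
  by (induction p rule: poly_mapping_single_induct)
     (auto simp: smul_single lookup_single smul_add lookup_add algebra_simps when_def)

lemma free_tensor_smul_left: "free_tensor (c \<odot> p) r = c \<odot> free_tensor p r"
  and free_tensor_smul_right: "free_tensor p (c \<odot> r) = c \<odot> free_tensor p r"
  by (intro poly_mapping_eqI; auto simp: lookup_free_tensor)+

lemma free_tensor_power: "free_tensor p r ^ n = free_tensor (p ^ n) (r ^ n)"
  by (induction n) (simp_all add: free_tensor_mult)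

lemma free_tensor_sum_left: "free_tensor (sum g B) r = (\<Sum>b\<in>B. free_tensor (g b) r)"
  and free_tensor_sum_right: "free_tensor p (sum g B) = (\<Sum>b\<in>B. free_tensor p (g b))"
  by (induction B rule: infinite_finite_induct;
      simp add: free_tensor_add_left free_tensor_add_right)+


section \<open>Iterated skew commutators\<close>

text \<open>Left and right multiplication by \<open>x\<close> commute, so this is the product of the
  operators L - g(s) R over s < t, applied to \<open>z\<close>. The order of the values of
  \<open>g\<close> does not affect the result but decides which inductions on \<open>t\<close> go
  through.\<close>

fun chain :: "(nat \<Rightarrow> 'k::field) \<Rightarrow> ('m::monoid_add \<Rightarrow>\<^sub>0 'k) \<Rightarrow> ('m \<Rightarrow>\<^sub>0 'k) \<Rightarrow> nat \<Rightarrow> ('m \<Rightarrow>\<^sub>0 'k)" where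
  "chain g x z 0 = z"
| "chain g x z (Suc t) = x * chain g x z t - g t \<odot> (chain g x z t * x)"

text \<open>Written with \<open>scal\<close> and this bracketing so that unfolding yields the
  relators of \<open>Uq_relations\<close> literally.\<close>

definition serre :: "'k::field \<Rightarrow> nat \<Rightarrow> ('m::monoid_add \<Rightarrow>\<^sub>0 'k) \<Rightarrow> ('m \<Rightarrow>\<^sub>0 'k) \<Rightarrow> ('m \<Rightarrow>\<^sub>0 'k)" where
  "serre p n x z = (\<Sum>s\<le>n. scal ((- 1) ^ s * q_binom p n s) * x ^ (n - s) * z * x ^ s)"

lemma serre_eq: "serre p n x z = (\<Sum>s\<le>n. ((- 1) ^ s * q_binom p n s) \<odot> (x ^ (n - s) * z * x ^ s))"
  by (simp add: serre_def smul_def mult.assoc)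

text \<open>The coefficient of X^s in the product of the factors 1 - g(t) X over t < m, that is,
  (-1)^s times an elementary symmetric polynomial in the values of \<open>g\<close>.\<close>

fun chain_coeff :: "(nat \<Rightarrow> 'k::field) \<Rightarrow> nat \<Rightarrow> nat \<Rightarrow> 'k" where
  "chain_coeff g 0 s = (if s = 0 then 1 else 0)"
| "chain_coeff g (Suc m) 0 = 1"
| "chain_coeff g (Suc m) (Suc s) = chain_coeff g m (Suc s) - g m * chain_coeff g m s"

lemma chain_coeff_0 [simp]: "chain_coeff g m 0 = 1"
  by (cases m) simp_all

lemma chain_coeff_gt: "s > m \<Longrightarrow> chain_coeff g m s = 0"
proof (induction m arbitrary: s)
  case (Suc m)
  then show ?case by (cases s) simp_all
qed simp

lemma chain_expand:
  "chain g x z m = (\<Sum>s\<le>m. chain_coeff g m s \<odot> (x ^ (m - s) * z * x ^ s))"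
proof (induction m)
  case (Suc m)
  let ?t = "\<lambda>s. x ^ (Suc m - s) * z * x ^ s"
  have 1: "x * chain g x z m = (\<Sum>s\<le>m. chain_coeff g m s \<odot> ?t s)"
    unfolding Suc by (simp add: sum_distrib_left Suc_diff_le mult.assoc)
  \<comment> \<open>Extending the range is free because the new coefficient vanishes; the first term
    can then be split off to align the two sums.\<close>
  also have "\<dots> = (\<Sum>s\<le>Suc m. chain_coeff g m s \<odot> ?t s)"
    by (simp add: chain_coeff_gt)
  also have "\<dots> = ?t 0 + (\<Sum>s\<le>m. chain_coeff g m (Suc s) \<odot> ?t (Suc s))"
    by (subst sum.atMost_Suc_shift) simp
  finally have 2: "x * chain g x z m = \<dots>" .
  have 3: "g m \<odot> (chain g x z m * x) = (\<Sum>s\<le>m. (g m * chain_coeff g m s) \<odot> ?t (Suc s))"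
    unfolding Suc by (simp add: sum_distrib_right smul_sum mult.assoc power_commutes)
  show ?case
    unfolding chain.simps 2 3
    by (subst sum.atMost_Suc_shift) (simp add: smul_diff_left sum_subtractf)
qed simp

section \<open>Quantum integers, quantum factorials and the q-Pascal rule\<close>

lemma q_int_nz:
  assumes "p \<noteq> 0" "\<forall>n>0. (p::'k::field) ^ n \<noteq> 1" "m > 0"
  shows "q_int p m \<noteq> 0"
proof -
  have *: "p ^ k \<noteq> inverse p ^ k" if "k > 0" for k
  proof
    assume "p ^ k = inverse p ^ k"
    then have "p ^ k * p ^ k = 1"
      using \<open>p \<noteq> 0\<close> by (simp add: power_inverse field_simps)
    then have "p ^ (k + k) = 1" by (simp add: power_add)
    then show False using assms(2) that by simp
  qed
  show ?thesis using *[of m] *[of 1] \<open>m > 0\<close> by (simp add: q_int_def)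
qed

text \<open>Excluding roots of unity serves this purpose: the q-binomials get nonzero
  denominators.\<close>

lemma q_fact_nz:
  assumes "p \<noteq> 0" "\<forall>n>0. (p::'k::field) ^ n \<noteq> 1"
  shows "q_fact p m \<noteq> 0"
  using q_int_nz[OF assms] by (simp add: q_fact_def)

lemma q_fact_Suc: "q_fact p (Suc m) = q_int p (Suc m) * q_fact p m"
  by (simp add: q_fact_def prod.nat_ivl_Suc' mult.commute)

text \<open>The addition formula [a+b] = p^(-b) [a] + p^a [b] for a = m - s and b = s + 1,
  multiplied by p^b. It is checked on numerators, so the common denominator may be anything.\<close>

lemma q_int_split:
  assumes "(p::'k::field) \<noteq> 0" "s \<le> m"
  shows "p ^ Suc s * q_int p (Suc m) = q_int p (m - s) + p ^ Suc m * q_int p (Suc s)"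
proof -
  obtain r where m: "m = s + r" using assms(2) le_Suc_ex by blast
  have "p ^ Suc s * (p ^ Suc m - inverse p ^ Suc m) =
      (p ^ r - inverse p ^ r) + p ^ Suc m * (p ^ Suc s - inverse p ^ Suc s)"
    using assms(1) by (simp add: m power_add field_simps)
  then have "p ^ Suc s * ((p ^ Suc m - inverse p ^ Suc m) / (p - inverse p)) =
      (p ^ r - inverse p ^ r) / (p - inverse p) + p ^ Suc m * ((p ^ Suc s - inverse p ^ Suc s) / (p - inverse p))"
    by (simp only: times_divide_eq_right add_divide_distrib[symmetric])
  then show ?thesis by (simp add: q_int_def m del: power_Suc)
qed

lemma q_binom_0: "p \<noteq> 0 \<Longrightarrow> \<forall>n>0. (p::'k::field) ^ n \<noteq> 1 \<Longrightarrow> q_binom p m 0 = 1"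
  and q_binom_self: "p \<noteq> 0 \<Longrightarrow> \<forall>n>0. (p::'k::field) ^ n \<noteq> 1 \<Longrightarrow> q_binom p m m = 1"
  using q_fact_nz[of p m] by (auto simp: q_binom_def q_fact_def)

text \<open>The bound s < m matters: by truncated subtraction \<open>q_binom p m (Suc m)\<close> is
  1/[m+1] instead of 0. Hence the top coefficient is a separate case in the induction below.\<close>

lemma q_binom_pascal:
  assumes p: "p \<noteq> 0" "\<forall>n>0. (p::'k::field) ^ n \<noteq> 1" and s: "s < m"
  shows "p ^ Suc s * q_binom p (Suc m) (Suc s) = q_binom p m (Suc s) + p ^ Suc m * q_binom p m s"
proof -
  obtain r where m: "m = Suc (s + r)" using s less_imp_Suc_add by blast
  note nz = q_fact_nz[OF p] q_int_nz[OF p, of "Suc _", simplified]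
  have d: "m - s = Suc r" "m - Suc s = r" "Suc m - Suc s = Suc r"
    by (simp_all add: m)
  have "p ^ Suc s * q_binom p (Suc m) (Suc s) =
      (p ^ Suc s * q_int p (Suc m)) * (q_fact p m / (q_fact p (Suc s) * q_fact p (Suc r)))"
    by (simp add: q_binom_def d q_fact_Suc[of p m])
  also have "\<dots> = (q_int p (Suc r) + p ^ Suc m * q_int p (Suc s)) *
      (q_fact p m / (q_fact p (Suc s) * q_fact p (Suc r)))"
    using q_int_split[OF p(1), of s m] s by (simp only: d less_imp_le)
  also have "\<dots> = q_binom p m (Suc s) + p ^ Suc m * q_binom p m s"
    unfolding q_binom_def d q_fact_Suc[of p s] q_fact_Suc[of p r] using nz
    by (simp add: field_simps del: power_Suc)
  finally show ?thesis .
qed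

lemma q_binom_inverse: "q_binom (inverse p) n s = q_binom (p::'k::field) n s"
proof -
  have "q_int (inverse p) m = q_int p m" for m
    unfolding q_int_def
    by (metis inverse_inverse_eq minus_diff_eq minus_divide_divide)
  then show ?thesis by (simp add: q_binom_def q_fact_def)
qed

text \<open>The \<open>q\<close>-binomial theorem for the product of the commuting operators
  \<open>z \<mapsto> x z - p\<^bsup>a+2t\<^esup> z x\<close>.\<close>

lemma chain_coeff_q_binom:
  assumes p: "p \<noteq> 0" "\<forall>n>0. (p::'k::field) ^ n \<noteq> 1"
  shows "s \<le> m \<Longrightarrow> chain_coeff (\<lambda>t. p powi (a + 2 * int t)) m s =
    (- 1) ^ s * q_binom p m s * p powi (int s * (a + int m - 1))"
proof (induction m arbitrary: s)
  case 0
  then show ?case using q_binom_0[OF p] by simp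
next
  case (Suc m)
  show ?case
  proof (cases s)
    case 0
    then show ?thesis using q_binom_0[OF p] by simp
  next
    case s: (Suc s')
    \<comment> \<open>\<open>c\<close> is the power of \<open>p\<close> in the coefficient at
      \<open>s'\<close>, and \<open>e\<close> the additional power at its successor. In these terms
      the recursion becomes the q-Pascal rule times e * c.\<close>
    define c where "c = p powi (int s' * (a + int m - 1))"
    define e where "e = p powi (a + int m - 1)"
    have pw: "p powi (int s * (a + int (Suc m) - 1)) = p ^ Suc s' * e * c"
    proof -
      have "int s * (a + int (Suc m) - 1) = int (Suc s') + (a + int m - 1) + int s' * (a + int m - 1)"
        by (simp add: s algebra_simps)
      then show ?thesis
        unfolding e_def c_def using p(1) by (simp only: power_int_add power_int_of_nat simp_thms)
    qed
    have g: "p powi (a + 2 * int m) = p ^ Suc m * e"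
    proof -
      have "a + 2 * int m = int (Suc m) + (a + int m - 1)" by simp
      then show ?thesis
        unfolding e_def using p(1) by (simp only: power_int_add power_int_of_nat simp_thms)
    qed
    have pw': "p powi (int (Suc s') * (a + int m - 1)) = e * c"
    proof -
      have "int (Suc s') * (a + int m - 1) = (a + int m - 1) + int s' * (a + int m - 1)"
        by (simp add: algebra_simps)
      then show ?thesis unfolding e_def c_def using p(1) by (simp only: power_int_add simp_thms)
    qed
    have IH: "chain_coeff (\<lambda>t. p powi (a + 2 * int t)) m s' = (- 1) ^ s' * q_binom p m s' * c"
      using Suc.IH[of s'] Suc.prems s by (simp add: c_def)
    show ?thesis
    proof (cases "s' = m")
      case True
      then show ?thesis
        unfolding pw unfolding s chain_coeff.simps g IH
        by (simp add: chain_coeff_gt q_binom_self[OF p])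
    next
      case False
      then have lt: "s' < m" using Suc.prems s by simp
      have IH': "chain_coeff (\<lambda>t. p powi (a + 2 * int t)) m (Suc s') =
          - ((- 1) ^ s' * q_binom p m (Suc s') * (e * c))"
        using Suc.IH[of "Suc s'"] lt unfolding pw' by simp
      have "chain_coeff (\<lambda>t. p powi (a + 2 * int t)) (Suc m) s =
          - ((- 1) ^ s' * (q_binom p m (Suc s') + p ^ Suc m * q_binom p m s') * (e * c))"
        unfolding s chain_coeff.simps IH IH' g by (simp add: algebra_simps)
      also have "\<dots> = (- 1) ^ s * q_binom p (Suc m) s * (p ^ Suc s' * e * c)"
        unfolding q_binom_pascal[OF p lt, symmetric] by (simp add: s)
      finally show ?thesis unfolding pw .
    qed
  qed
qed

text \<open>The choice n = 1 - c makes the exponent s (c + n - 1) of the q-binomial theorem vanish,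
  which leaves the bare Serre coefficients. The second form follows by replacing p with its inverse,
  which does not change the q-binomials.\<close>

lemma serre_eq_chain:
  assumes p: "p \<noteq> 0" "\<forall>n>0. (p::'k::field) ^ n \<noteq> 1" and c: "int n = 1 - c"
  shows "serre p n x z = chain (\<lambda>t. p powi (c + 2 * int t)) x z n"
    and "serre p n x z = chain (\<lambda>t. p powi (- c - 2 * int t)) x z n"
proof -
  have p': "inverse p \<noteq> 0" "\<forall>n>0. inverse p ^ n \<noteq> 1"
    using p by (auto simp: power_inverse)
  have 0: "int s * (c + int n - 1) = 0" for s by (simp add: c)
  show "serre p n x z = chain (\<lambda>t. p powi (c + 2 * int t)) x z n"
    unfolding serre_eq chain_expand
    by (intro sum.cong refl) (simp add: chain_coeff_q_binom[OF p] 0)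
  have "(\<lambda>t. p powi (- c - 2 * int t)) = (\<lambda>t. inverse p powi (c + 2 * int t))"
  proof
    fix t
    have "p powi (- (c + 2 * int t)) = inverse p powi (c + 2 * int t)"
      by (simp only: power_int_minus power_int_inverse)
    then show "p powi (- c - 2 * int t) = inverse p powi (c + 2 * int t)" by simp
  qed
  then show "serre p n x z = chain (\<lambda>t. p powi (- c - 2 * int t)) x z n"
    unfolding serre_eq chain_expand
    by (intro sum.cong refl)
       (simp add: chain_coeff_q_binom[OF p'] 0 q_binom_inverse)
qed

section \<open>Skew commutators modulo an ideal\<close>

lemma chain_cong:
  assumes "two_sided J" "x \<approx>\<^bsub>J\<^esub> x'" "z \<approx>\<^bsub>J\<^esub> z'"
  shows "chain g x z t \<approx>\<^bsub>J\<^esub> chain g x' z' t"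
  by (induction t) (use assms in \<open>auto intro!: idcong_intros\<close>)

text \<open>Every monomial of the chain has degree \<open>t\<close> in \<open>x\<close> and degree 1
  in \<open>z\<close>, so \<open>y\<close> collects the same factor from each of them.\<close>

lemma chain_skew:
  assumes J: "two_sided J" and x: "y * x \<approx>\<^bsub>J\<^esub> a \<odot> (x * y)" and z: "y * z \<approx>\<^bsub>J\<^esub> b \<odot> (z * y)"
  shows "y * chain g x z t \<approx>\<^bsub>J\<^esub> (b * a ^ t) \<odot> (chain g x z t * y)"
proof (induction t)
  case (Suc t)
  let ?C = "chain g x z t" and ?e = "b * a ^ t"
  have 1: "y * (x * ?C) \<approx>\<^bsub>J\<^esub> (a * ?e) \<odot> (x * ?C * y)"
  proof -
    have "(y * x) * ?C \<approx>\<^bsub>J\<^esub> (a \<odot> (x * y)) * ?C"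
      by (intro idcong_intros J x)
    moreover have "a \<odot> (x * (y * ?C)) \<approx>\<^bsub>J\<^esub> a \<odot> (x * (?e \<odot> (?C * y)))"
      by (intro idcong_intros J Suc)
    ultimately show ?thesis
      using idcong_trans[OF J] by (simp add: mult.assoc)
  qed
  have 2: "y * (?C * x) \<approx>\<^bsub>J\<^esub> (a * ?e) \<odot> (?C * x * y)"
  proof -
    have "(y * ?C) * x \<approx>\<^bsub>J\<^esub> (?e \<odot> (?C * y)) * x"
      by (intro idcong_intros J Suc)
    moreover have "?e \<odot> (?C * (y * x)) \<approx>\<^bsub>J\<^esub> ?e \<odot> (?C * (a \<odot> (x * y)))"
      by (intro idcong_intros J x)
    ultimately show ?thesis
      using idcong_trans[OF J] by (simp add: mult.assoc mult.commute)
  qed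
  have "y * (x * ?C) - g t \<odot> (y * (?C * x)) \<approx>\<^bsub>J\<^esub>
      (a * ?e) \<odot> (x * ?C * y) - g t \<odot> (a * ?e) \<odot> (?C * x * y)"
    by (intro idcong_diff idcong_smul J 1 2)
  then show ?case
    by (simp add: algebra_simps smul_diff)
qed (use z in simp)

text \<open>The value of \<open>g\<close> at each step is the factor from \<open>chain_skew\<close>,
  so the contribution of \<open>y\<close> to the outermost skew commutator is congruent to
  0.\<close>

lemma chain_absorb:
  assumes J: "two_sided J" and x: "y * x \<approx>\<^bsub>J\<^esub> a \<odot> (x * y)" and z: "y * z \<approx>\<^bsub>J\<^esub> b \<odot> (z * y)"
    and g: "\<And>t. g t = b * a ^ t"
  shows "chain g (x + y) z t \<approx>\<^bsub>J\<^esub> chain g x z t"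
proof -
  note [trans] = idcong_trans[OF J]
  show ?thesis
  proof (induction t)
    case (Suc t)
    let ?C = "chain g x z t"
    have "chain g (x + y) z (Suc t) \<approx>\<^bsub>J\<^esub> (x + y) * ?C - g t \<odot> (?C * (x + y))"
      unfolding chain.simps by (intro idcong_intros J Suc)
    also have "(x + y) * ?C - g t \<odot> (?C * (x + y)) =
        chain g x z (Suc t) + (y * ?C - g t \<odot> (?C * y))"
      by (simp add: algebra_simps smul_add)
    also have "\<dots> \<approx>\<^bsub>J\<^esub> chain g x z (Suc t) + (g t \<odot> (?C * y) - g t \<odot> (?C * y))"
      unfolding g by (intro idcong_intros J chain_skew x z)
    finally show ?case by simp
  qed (use J idcong_refl in auto)
qed

lemma power_powi: "(p::'k::field) \<noteq> 0 \<Longrightarrow> p powi c * (p powi m) ^ t = p powi (c + m * int t)"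
  by (simp add: power_int_add power_int_power')

text \<open>The two summands of \<open>z + w\<close> are treated with the two opposite orders of the factors in
  the product of skew commutators.\<close>

lemma serre_coproduct:
  assumes J: "two_sided J" and p: "p \<noteq> 0" "\<forall>n>0. (p::'k::field) ^ n \<noteq> 1" and c: "int n = 1 - c"
    and yx: "y * x \<approx>\<^bsub>J\<^esub> p\<^sup>2 \<odot> (x * y)"
    and yz: "y * z \<approx>\<^bsub>J\<^esub> p powi c \<odot> (z * y)"
    and wx: "w * x \<approx>\<^bsub>J\<^esub> p powi c \<odot> (x * w)"
  shows "serre p n (x + y) (z + w) \<approx>\<^bsub>J\<^esub> serre p n x z + serre p n y w"
proof -
  have inv: "v * u \<approx>\<^bsub>J\<^esub> p powi (- m) \<odot> (u * v)" if "u * v \<approx>\<^bsub>J\<^esub> p powi m \<odot> (v * u)" for u v m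
  proof -
    have "p powi (- m) \<odot> (u * v) \<approx>\<^bsub>J\<^esub> p powi (- m) \<odot> (p powi m \<odot> (v * u))"
      by (intro idcong_smul J that)
    moreover have "p powi (- m) * p powi m = 1"
      using p(1) by (simp add: power_int_minus)
    ultimately show ?thesis by (simp add: idcong_sym[OF J])
  qed
  have yx: "y * x \<approx>\<^bsub>J\<^esub> p powi 2 \<odot> (x * y)" using yx by simp
  have add: "serre p n u (z + w) = serre p n u z + serre p n u w" for u
    by (simp add: serre_eq algebra_simps smul_add sum.distrib)
  have 1: "serre p n (x + y) z \<approx>\<^bsub>J\<^esub> serre p n x z"
    unfolding serre_eq_chain(1)[OF p c]
    by (rule chain_absorb[OF J yx yz]) (simp only: power_powi[OF p(1)])
  have 2: "serre p n (y + x) w \<approx>\<^bsub>J\<^esub> serre p n y w"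
    unfolding serre_eq_chain(2)[OF p c]
    by (rule chain_absorb[OF J inv[OF yx] inv[OF wx]]) (simp only: power_powi[OF p(1)], simp)
  show ?thesis
    unfolding add using idcong_add[OF J 1 2] by (simp add: add.commute)
qed

text \<open>Used for the antipode, which attaches a group-like factor to each generator. The same
  \<open>b\<close> occurs in \<open>kf\<close> and \<open>le\<close>: moving \<open>e\<close> past
  k^t l and moving the chain past \<open>k\<close> then cost the same inverse of b a^t, so both
  halves of the commutator are rescaled equally and the group-like part can be pulled out. The
  scalar \<open>h\<close> stays anonymous because only membership in the ideal is wanted.\<close>

lemma chain_twist:
  assumes J: "two_sided J" and nz: "a \<noteq> 0" "b \<noteq> 0"
    and ke: "k * e \<approx>\<^bsub>J\<^esub> a \<odot> (e * k)" and kf: "k * f \<approx>\<^bsub>J\<^esub> b \<odot> (f * k)"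
    and le: "l * e \<approx>\<^bsub>J\<^esub> b \<odot> (e * l)" and kl: "k * l \<approx>\<^bsub>J\<^esub> l * k"
  shows "\<exists>h. chain g (k * e) (l * f) t \<approx>\<^bsub>J\<^esub> h \<odot> (k ^ t * l * chain g e f t)"
proof -
  note [trans] = idcong_trans[OF J]
  show ?thesis
  proof (induction t)
    case 0
    then show ?case using idcong_refl[OF J] by (intro exI[of _ 1]) simp
  next
    case (Suc t)
    then obtain h where h: "chain g (k * e) (l * f) t \<approx>\<^bsub>J\<^esub> h \<odot> (k ^ t * l * chain g e f t)"
      by blast
    let ?C = "chain g e f t" and ?s = "inverse (b * a ^ t)"
    have nzt: "b * a ^ t \<noteq> 0" using nz by simp
    have inv: "v * u \<approx>\<^bsub>J\<^esub> inverse m \<odot> (u * v)" if "u * v \<approx>\<^bsub>J\<^esub> m \<odot> (v * u)" "m \<noteq> 0" for u v m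
    proof -
      have "inverse m \<odot> (u * v) \<approx>\<^bsub>J\<^esub> inverse m \<odot> m \<odot> (v * u)"
        by (intro idcong_smul J that)
      then show ?thesis using that by (simp add: idcong_sym[OF J])
    qed
    have kt: "k ^ t * e \<approx>\<^bsub>J\<^esub> a ^ t \<odot> (e * k ^ t)" for t
    proof (induction t)
      case (Suc t)
      have "k * (k ^ t * e) \<approx>\<^bsub>J\<^esub> k * (a ^ t \<odot> (e * k ^ t))"
        by (intro idcong_intros J Suc)
      also have "k * (a ^ t \<odot> (e * k ^ t)) = a ^ t \<odot> (k * e) * k ^ t"
        by (simp add: mult.assoc)
      also have "a ^ t \<odot> (k * e) * k ^ t \<approx>\<^bsub>J\<^esub> a ^ t \<odot> (a \<odot> (e * k)) * k ^ t"
        by (intro idcong_intros J ke)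
      finally show ?case by (simp add: mult.assoc mult.commute)
    qed (use idcong_refl[OF J] in simp)
    have klt: "k ^ t * l * k \<approx>\<^bsub>J\<^esub> k ^ Suc t * l"
    proof -
      have "k ^ t * (l * k) \<approx>\<^bsub>J\<^esub> k ^ t * (k * l)"
        by (intro idcong_intros J idcong_sym[OF J kl])
      then show ?thesis by (simp add: mult.assoc power_Suc2 del: power_Suc)
    qed
    have kte: "k ^ t * l * e \<approx>\<^bsub>J\<^esub> (b * a ^ t) \<odot> (e * (k ^ t * l))"
    proof -
      have "k ^ t * (l * e) \<approx>\<^bsub>J\<^esub> k ^ t * (b \<odot> (e * l))"
        by (intro idcong_intros J le)
      also have "k ^ t * (b \<odot> (e * l)) = b \<odot> (k ^ t * e) * l"
        by (simp add: mult.assoc)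
      also have "b \<odot> (k ^ t * e) * l \<approx>\<^bsub>J\<^esub> b \<odot> (a ^ t \<odot> (e * k ^ t)) * l"
        by (intro idcong_intros J kt)
      finally show ?thesis by (simp add: mult.assoc)
    qed
    have 1: "k * e * (k ^ t * l * ?C) \<approx>\<^bsub>J\<^esub> ?s \<odot> (k ^ Suc t * l * (e * ?C))"
    proof -
      have "k * (e * (k ^ t * l)) * ?C \<approx>\<^bsub>J\<^esub> k * (?s \<odot> (k ^ t * l * e)) * ?C"
        by (intro idcong_intros J inv[OF kte nzt])
      then show ?thesis by (simp add: mult.assoc)
    qed
    have 2: "k ^ t * l * ?C * (k * e) \<approx>\<^bsub>J\<^esub> ?s \<odot> (k ^ Suc t * l * (?C * e))"
    proof -
      have "k ^ t * l * (?C * k) * e \<approx>\<^bsub>J\<^esub> k ^ t * l * (?s \<odot> (k * ?C)) * e"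
        by (intro idcong_intros J inv[OF chain_skew[OF J ke kf] nzt])
      moreover have "?s \<odot> (k ^ t * l * k) * (?C * e) \<approx>\<^bsub>J\<^esub> ?s \<odot> (k ^ Suc t * l) * (?C * e)"
        by (intro idcong_intros J klt)
      ultimately show ?thesis using idcong_trans[OF J] by (simp add: mult.assoc)
    qed
    have "chain g (k * e) (l * f) (Suc t) \<approx>\<^bsub>J\<^esub>
        k * e * (h \<odot> (k ^ t * l * ?C)) - g t \<odot> ((h \<odot> (k ^ t * l * ?C)) * (k * e))"
      unfolding chain.simps by (intro idcong_intros J h)
    also have "k * e * (h \<odot> (k ^ t * l * ?C)) - g t \<odot> ((h \<odot> (k ^ t * l * ?C)) * (k * e)) =
        h \<odot> (k * e * (k ^ t * l * ?C)) - (g t * h) \<odot> (k ^ t * l * ?C * (k * e))"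
      by simp
    also have "\<dots> \<approx>\<^bsub>J\<^esub> h \<odot> (?s \<odot> (k ^ Suc t * l * (e * ?C))) - (g t * h) \<odot> (?s \<odot> (k ^ Suc t * l * (?C * e)))"
      by (intro idcong_diff idcong_smul J 1 2)
    also have "h \<odot> (?s \<odot> (k ^ Suc t * l * (e * ?C))) - (g t * h) \<odot> (?s \<odot> (k ^ Suc t * l * (?C * e))) =
        (h * ?s) \<odot> (k ^ Suc t * l * chain g e f (Suc t))"
      by (simp add: algebra_simps smul_diff del: power_Suc)
    finally show ?case by blast
  qed
qed

lemma serre_twist:
  assumes J: "two_sided J" and p: "p \<noteq> 0" "\<forall>n>0. (p::'k::field) ^ n \<noteq> 1" and c: "int n = 1 - c"
    and nz: "a \<noteq> 0" "b \<noteq> 0"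
    and ke: "k * e \<approx>\<^bsub>J\<^esub> a \<odot> (e * k)" and kf: "k * f \<approx>\<^bsub>J\<^esub> b \<odot> (f * k)"
    and le: "l * e \<approx>\<^bsub>J\<^esub> b \<odot> (e * l)" and kl: "k * l \<approx>\<^bsub>J\<^esub> l * k"
    and x: "x \<approx>\<^bsub>J\<^esub> k * e" and z: "z \<approx>\<^bsub>J\<^esub> l * f" and mem: "serre p n e f \<in> J"
  shows "serre p n x z \<in> J"
proof -
  note eq = serre_eq_chain(1)[OF p c]
  obtain h where h: "chain (\<lambda>t. p powi (c + 2 * int t)) (k * e) (l * f) n
      \<approx>\<^bsub>J\<^esub> h \<odot> (k ^ n * l * serre p n e f)"
    unfolding eq using chain_twist[OF J nz ke kf le kl] by blast
  have "serre p n x z \<approx>\<^bsub>J\<^esub> h \<odot> (k ^ n * l * serre p n e f)"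
    unfolding eq[of x z] by (rule idcong_trans[OF J chain_cong[OF J x z] h])
  then show ?thesis
    by (rule idcong_mem[OF J]) (intro two_sided_smul two_sided_mult_left J mem)
qed

text \<open>An antihomomorphism reverses words and thus exchanges s with n - s; the q-binomials are
  symmetric, and only the sign (-1)^n remains.\<close>

lemma serre_reverse:
  "(\<Sum>s\<le>n. ((- 1) ^ s * q_binom p n s) \<odot> (x ^ s * z * x ^ (n - s))) = (- 1) ^ n \<odot> serre p n x z"
proof -
  have "(\<Sum>s\<le>n. ((- 1) ^ s * q_binom p n s) \<odot> (x ^ s * z * x ^ (n - s))) =
      (\<Sum>s\<le>n. ((- 1) ^ (n - s) * q_binom p n (n - s)) \<odot> (x ^ (n - s) * z * x ^ (n - (n - s))))"
    by (rule sum.reindex_bij_witness[of _ "\<lambda>s. n - s" "\<lambda>s. n - s"]) auto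
  also have "\<dots> = (\<Sum>s\<le>n. ((- 1) ^ n * ((- 1) ^ s * q_binom p n s)) \<odot> (x ^ (n - s) * z * x ^ s))"
  proof (intro sum.cong refl)
    fix s assume "s \<in> {..n}"
    then have s: "s \<le> n" by simp
    have "(- 1 :: 'b) ^ n * (- 1) ^ s = (- 1) ^ (n - s)"
      using s by (simp add: power_add[symmetric] minus_one_power_iff)
    moreover have "q_binom p n (n - s) = q_binom p n s"
      using s by (simp add: q_binom_def mult.commute)
    ultimately show "((- 1) ^ (n - s) * q_binom p n (n - s)) \<odot> (x ^ (n - s) * z * x ^ (n - (n - s))) =
        ((- 1) ^ n * ((- 1) ^ s * q_binom p n s)) \<odot> (x ^ (n - s) * z * x ^ s)"
      using s by (simp add: mult.assoc[symmetric])
  qed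
  finally show ?thesis by (simp add: serre_eq smul_sum)
qed


section \<open>Comultiplication and antipode respect the defining relations\<close>

lemma alg_ext_serre: "alg_ext f (serre p n x z) = serre p n (alg_ext f x) (alg_ext f z)"
  by (simp add: serre_eq alg_ext_sum alg_ext_smul alg_ext_mult alg_ext_power)

lemma antialg_ext_serre:
  "antialg_ext f (serre p n x z) = (- 1) ^ n \<odot> serre p n (antialg_ext f x) (antialg_ext f z)"
  unfolding serre_reverse[symmetric]
  by (simp add: serre_eq antialg_ext_sum antialg_ext_smul antialg_ext_mult antialg_ext_power mult.assoc)

locale quantized =
  fixes A :: "'i::finite \<Rightarrow> 'i \<Rightarrow> int" and d :: "'i \<Rightarrow> nat" and q :: "'k::field_char_0"
  assumes cartan: "semisimple_cartan A d" and q_nz: "q \<noteq> 0" and q_nroot: "\<forall>n>0. q ^ n \<noteq> 1"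
begin

abbreviation I where "I \<equiv> Uq_ideal A d q"
abbreviation J where "J \<equiv> Uq2_ideal A d q"
abbreviation \<Delta> :: "('i, 'k) free_alg \<Rightarrow> ('i, 'k) free_alg2" where "\<Delta> \<equiv> alg_ext comult_gen"
abbreviation \<sigma> :: "('i, 'k) free_alg \<Rightarrow> ('i, 'k) free_alg" where "\<sigma> \<equiv> antialg_ext antipode_gen"
abbreviation r where "r i j \<equiv> root_pairing A d i j"

lemma I: "two_sided I"
  by (simp add: Uq_ideal_def two_sided_Idl)

lemma J: "two_sided J"
  by (simp add: Uq2_ideal_def two_sided_Idl)

lemmas [trans] = idcong_trans[OF I] idcong_trans[OF J]

lemma r_sym: "r i j = r j i"
  using cartan by (simp add: root_pairing_def semisimple_cartan_def)

lemma rel: "x \<in> Uq_relations A d q \<Longrightarrow> x \<in> I"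
  unfolding Uq_ideal_def by (rule Idl_superset)

lemma rel_cong: "x - y \<in> Uq_relations A d q \<Longrightarrow> x \<approx>\<^bsub>I\<^esub> y"
  unfolding idcong_def by (rule rel)

lemma powi_nz: "q powi m \<noteq> 0"
  using q_nz by simp

section \<open>Commutation rules that follow from the defining relations\<close>

lemma K_Ki: "tK i * tKi i \<approx>\<^bsub>I\<^esub> 1" and Ki_K: "tKi i * tK i \<approx>\<^bsub>I\<^esub> 1"
  by (rule rel_cong, rule Uq_relations.intros)+

lemma skew_move:
  assumes "y * x \<approx>\<^bsub>I\<^esub> c \<odot> (x * y)" "c \<noteq> 0"
  shows "x * y \<approx>\<^bsub>I\<^esub> inverse c \<odot> (y * x)"
proof -
  have "inverse c \<odot> (y * x) \<approx>\<^bsub>I\<^esub> inverse c \<odot> (c \<odot> (x * y))"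
    by (intro idcong_smul I assms)
  then show ?thesis using assms(2) by (simp add: idcong_sym[OF I])
qed

text \<open>\<open>x\<close> is arbitrary so that c = 1 also yields commutation of the inverses with
  the \<open>tK j\<close> and with each other, which the relations state only for the
  \<open>tK j\<close> themselves.\<close>

lemma skew_Ki:
  assumes x: "tK i * x \<approx>\<^bsub>I\<^esub> c \<odot> (x * tK i)" and c: "c \<noteq> 0"
  shows "tKi i * x \<approx>\<^bsub>I\<^esub> inverse c \<odot> (x * tKi i)"
proof -
  have "tKi i * x * 1 \<approx>\<^bsub>I\<^esub> tKi i * x * (tK i * tKi i)"
    by (intro idcong_intros I idcong_sym[OF I K_Ki])
  also have "\<dots> = tKi i * (x * tK i) * tKi i"
    by (simp add: mult.assoc)
  also have "\<dots> \<approx>\<^bsub>I\<^esub> tKi i * (inverse c \<odot> (tK i * x)) * tKi i"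
    by (intro idcong_intros I skew_move x c)
  also have "\<dots> = inverse c \<odot> ((tKi i * tK i) * x * tKi i)"
    by (simp add: mult.assoc)
  also have "\<dots> \<approx>\<^bsub>I\<^esub> inverse c \<odot> (1 * x * tKi i)"
    by (intro idcong_intros I Ki_K)
  finally show ?thesis by simp
qed

lemma skew_K:
  assumes "tK i * x * tKi i \<approx>\<^bsub>I\<^esub> c \<odot> x"
  shows "tK i * x \<approx>\<^bsub>I\<^esub> c \<odot> (x * tK i)"
proof -
  have "tK i * x * 1 \<approx>\<^bsub>I\<^esub> tK i * x * (tKi i * tK i)"
    by (intro idcong_intros I idcong_sym[OF I Ki_K])
  also have "\<dots> = (tK i * x * tKi i) * tK i"
    by (simp add: mult.assoc)
  also have "\<dots> \<approx>\<^bsub>I\<^esub> (c \<odot> x) * tK i"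
    by (intro idcong_intros I assms)
  finally show ?thesis by simp
qed

lemma K_E_Ki: "tK i * tE j * tKi i \<approx>\<^bsub>I\<^esub> q powi r i j \<odot> tE j"
  unfolding smul_def by (rule rel_cong) (rule Uq_relations.intros)

lemma K_F_Ki: "tK i * tF j * tKi i \<approx>\<^bsub>I\<^esub> q powi (- r i j) \<odot> tF j"
  unfolding smul_def by (rule rel_cong) (rule Uq_relations.intros)

lemma K_E: "tK i * tE j \<approx>\<^bsub>I\<^esub> q powi r i j \<odot> (tE j * tK i)"
  by (rule skew_K[OF K_E_Ki])

lemma K_F: "tK i * tF j \<approx>\<^bsub>I\<^esub> q powi (- r i j) \<odot> (tF j * tK i)"
  by (rule skew_K[OF K_F_Ki])

lemma Ki_E: "tKi i * tE j \<approx>\<^bsub>I\<^esub> q powi (- r i j) \<odot> (tE j * tKi i)"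
  using skew_Ki[OF K_E powi_nz] by (simp add: power_int_minus)

lemma Ki_F: "tKi i * tF j \<approx>\<^bsub>I\<^esub> q powi r i j \<odot> (tF j * tKi i)"
  using skew_Ki[OF K_F powi_nz] by (simp add: power_int_minus)

lemma K_comm: "tK i * tK j \<approx>\<^bsub>I\<^esub> tK j * tK i"
  by (rule rel_cong) (rule Uq_relations.intros)

lemma Ki_K_comm: "tKi i * tK j \<approx>\<^bsub>I\<^esub> tK j * tKi i"
  using skew_Ki[of i "tK j" 1] K_comm by simp

lemma Ki_Ki: "tKi i * tKi j \<approx>\<^bsub>I\<^esub> tKi j * tKi i"
  using skew_Ki[of i "tKi j" 1] idcong_sym[OF I Ki_K_comm] by simp

definition EF_rhs :: "'i \<Rightarrow> 'i \<Rightarrow> ('i, 'k) free_alg" where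
  "EF_rhs i j = (if i = j then (1 / (q ^ d i - inverse (q ^ d i))) \<odot> (tK i - tKi i) else 0)"

lemma E_F: "tE i * tF j - tF j * tE i \<approx>\<^bsub>I\<^esub> EF_rhs i j"
  unfolding EF_rhs_def smul_def by (rule rel_cong) (rule Uq_relations.intros)

lemma Serre_E_mem: "i \<noteq> j \<Longrightarrow> serre (q ^ d i) (nat (1 - A i j)) (tE i) (tE j) \<in> I"
  unfolding serre_def by (rule rel) (rule Uq_relations.intros)

lemma Serre_F_mem: "i \<noteq> j \<Longrightarrow> serre (q ^ d i) (nat (1 - A i j)) (tF i) (tF j) \<in> I"
  unfolding serre_def by (rule rel) (rule Uq_relations.intros)

lemma qi_nz: "q ^ d i \<noteq> 0"
  using q_nz by simp

lemma qi_nroot: "\<forall>n>0. (q ^ d i) ^ n \<noteq> 1"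
  using q_nroot cartan by (auto simp: power_mult[symmetric] semisimple_cartan_def)

lemma int_n:
  assumes "i \<noteq> j"
  shows "int (nat (1 - A i j)) = 1 - A i j"
proof -
  have "A i j \<le> 0"
    using cartan assms unfolding semisimple_cartan_def by blast
  then show ?thesis by simp
qed

lemma q_r: "q powi r i j = (q ^ d i) powi A i j"
  by (simp add: root_pairing_def power_int_mult)

lemma q_r_diag: "q powi r i i = (q ^ d i)\<^sup>2"
  using cartan unfolding q_r by (simp add: semisimple_cartan_def)

section \<open>The ideal of the tensor square and the coproduct\<close>

lemma tensor_mem_left: "p \<in> I \<Longrightarrow> free_tensor p s \<in> J"
proof -
  assume p: "p \<in> I"
  then have "free_tensor p 1 \<in> J"
    unfolding Uq2_ideal_def by (intro Idl_superset) auto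
  then have "free_tensor p 1 * free_tensor 1 s \<in> J"
    by (rule two_sided_mult_right[OF J])
  then show ?thesis by (simp add: free_tensor_mult)
qed

lemma tensor_mem_right: "p \<in> I \<Longrightarrow> free_tensor s p \<in> J"
proof -
  assume p: "p \<in> I"
  then have "free_tensor 1 p \<in> J"
    unfolding Uq2_ideal_def by (intro Idl_superset) auto
  then have "free_tensor s 1 * free_tensor 1 p \<in> J"
    by (rule two_sided_mult_left[OF J])
  then show ?thesis by (simp add: free_tensor_mult)
qed

lemma tensor_cong:
  assumes "p \<approx>\<^bsub>I\<^esub> p'" "s \<approx>\<^bsub>I\<^esub> s'"
  shows "free_tensor p s \<approx>\<^bsub>J\<^esub> free_tensor p' s'"
proof -
  have "free_tensor (p - p') s + free_tensor p' (s - s') \<in> J"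
    using assms unfolding idcong_def
    by (intro two_sided_add J tensor_mem_left tensor_mem_right)
  then show ?thesis
    by (simp add: idcong_def free_tensor_diff_left free_tensor_diff_right)
qed

lemma power_comm_collect:
  assumes "k * l \<approx>\<^bsub>I\<^esub> l * k"
  shows "k ^ m * l * k ^ s \<approx>\<^bsub>I\<^esub> k ^ (m + s) * l"
proof (induction s)
  case (Suc s)
  have "k ^ m * l * k ^ Suc s = (k ^ m * l * k ^ s) * k"
    by (simp add: mult.assoc power_Suc2 del: power_Suc)
  also have "\<dots> \<approx>\<^bsub>I\<^esub> k ^ (m + s) * l * k"
    by (intro idcong_intros I Suc)
  also have "\<dots> = k ^ (m + s) * (l * k)"
    by (simp add: mult.assoc)
  also have "\<dots> \<approx>\<^bsub>I\<^esub> k ^ (m + s) * (k * l)"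
    by (intro idcong_intros I idcong_sym[OF I assms])
  also have "\<dots> = k ^ (m + Suc s) * l"
    by (simp add: mult.assoc[symmetric] power_Suc2 del: power_Suc)
  finally show ?case .
qed (use idcong_refl[OF I] in simp)

text \<open>In the slot of the commuting elements every summand collects to k^n l, independently of
  s. The sum therefore factors as this element tensored with a Serre relator.\<close>

lemma serre_tensor_mem:
  assumes kl: "k * l \<approx>\<^bsub>I\<^esub> l * k" and mem: "serre p n x z \<in> I"
  shows "serre p n (free_tensor k x) (free_tensor l z) \<in> J"
    and "serre p n (free_tensor x k) (free_tensor z l) \<in> J"
proof -
  have collect: "k ^ (n - s) * l * k ^ s \<approx>\<^bsub>I\<^esub> k ^ n * l" if "s \<le> n" for s
    using power_comm_collect[OF kl, of "n - s" s] that by simp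
  have sum_cong: "sum f {..n} \<approx>\<^bsub>J\<^esub> sum g {..n}" if "\<And>s. s \<le> n \<Longrightarrow> f s \<approx>\<^bsub>J\<^esub> g s" for f g
    using two_sided_sum[OF J, of "{..n}" "\<lambda>s. f s - g s"] that
    by (simp add: idcong_def sum_subtractf)
  have "serre p n (free_tensor k x) (free_tensor l z) =
      (\<Sum>s\<le>n. ((- 1) ^ s * q_binom p n s) \<odot>
        free_tensor (k ^ (n - s) * l * k ^ s) (x ^ (n - s) * z * x ^ s))"
    by (simp add: serre_eq free_tensor_power free_tensor_mult)
  also have "\<dots> \<approx>\<^bsub>J\<^esub> (\<Sum>s\<le>n. ((- 1) ^ s * q_binom p n s) \<odot>
        free_tensor (k ^ n * l) (x ^ (n - s) * z * x ^ s))"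
    by (intro sum_cong idcong_smul J tensor_cong collect idcong_refl I)
  also have "\<dots> = free_tensor (k ^ n * l) (serre p n x z)"
    by (simp add: serre_eq free_tensor_sum_right free_tensor_smul_right)
  finally show "serre p n (free_tensor k x) (free_tensor l z) \<in> J"
    by (rule idcong_mem[OF J]) (rule tensor_mem_right[OF mem])
  have "serre p n (free_tensor x k) (free_tensor z l) =
      (\<Sum>s\<le>n. ((- 1) ^ s * q_binom p n s) \<odot>
        free_tensor (x ^ (n - s) * z * x ^ s) (k ^ (n - s) * l * k ^ s))"
    by (simp add: serre_eq free_tensor_power free_tensor_mult)
  also have "\<dots> \<approx>\<^bsub>J\<^esub> (\<Sum>s\<le>n. ((- 1) ^ s * q_binom p n s) \<odot>
        free_tensor (x ^ (n - s) * z * x ^ s) (k ^ n * l))"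
    by (intro sum_cong idcong_smul J tensor_cong collect idcong_refl I)
  also have "\<dots> = free_tensor (serre p n x z) (k ^ n * l)"
    by (simp add: serre_eq free_tensor_sum_left free_tensor_smul_left)
  finally show "serre p n (free_tensor x k) (free_tensor z l) \<in> J"
    by (rule idcong_mem[OF J]) (rule tensor_mem_left[OF mem])
qed

lemmas comult_simps = alg_ext_mult alg_ext_add alg_ext_diff alg_ext_smul free_tensor_mult

lemma tensor_smul_cong_left:
  assumes "p \<approx>\<^bsub>I\<^esub> c \<odot> p'"
  shows "free_tensor p s \<approx>\<^bsub>J\<^esub> c \<odot> free_tensor p' s"
  using tensor_cong[OF assms idcong_refl[OF I]] by (simp add: free_tensor_smul_left)

lemma tensor_smul_cong_right:
  assumes "p \<approx>\<^bsub>I\<^esub> c \<odot> p'"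
  shows "free_tensor s p \<approx>\<^bsub>J\<^esub> c \<odot> free_tensor s p'"
  using tensor_cong[OF idcong_refl[OF I] assms] by (simp add: free_tensor_smul_right)

lemma K_x_Ki: "tK i * tK j * tKi i \<approx>\<^bsub>I\<^esub> tK j" "tK i * tKi j * tKi i \<approx>\<^bsub>I\<^esub> tKi j"
proof -
  have *: "tK i * x * tKi i \<approx>\<^bsub>I\<^esub> x" if "tK i * x \<approx>\<^bsub>I\<^esub> x * tK i" for x
  proof -
    have "tK i * x * tKi i \<approx>\<^bsub>I\<^esub> x * tK i * tKi i"
      by (intro idcong_intros I that)
    also have "\<dots> = x * (tK i * tKi i)" by (simp add: mult.assoc)
    also have "\<dots> \<approx>\<^bsub>I\<^esub> x * 1" by (intro idcong_intros I K_Ki)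
    finally show ?thesis by simp
  qed
  show "tK i * tK j * tKi i \<approx>\<^bsub>I\<^esub> tK j" "tK i * tKi j * tKi i \<approx>\<^bsub>I\<^esub> tKi j"
    by (intro * K_comm idcong_sym[OF I Ki_K_comm])+
qed

lemma comult_E_F:
  "\<Delta> (tE i * tF j - tF j * tE i) \<approx>\<^bsub>J\<^esub> \<Delta> (EF_rhs i j)"
proof -
  have 1: "\<Delta> (tE i * tF j - tF j * tE i) =
      free_tensor (tE i * tF j - tF j * tE i) (tKi j) + free_tensor (tK i) (tE i * tF j - tF j * tE i)
      + (free_tensor (tK i * tF j) (tE i * tKi j) - free_tensor (tF j * tK i) (tKi j * tE i))"
    by (simp add: comult_simps algebra_simps free_tensor_diff_left free_tensor_diff_right)
  \<comment> \<open>The E (x) F terms have already cancelled. The two remaining cross terms agree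
    because the exchange factors in the two slots are inverse to each other, by symmetry of the
    pairing.\<close>
  have "tE i * tKi j \<approx>\<^bsub>I\<^esub> q powi r j i \<odot> (tKi j * tE i)"
    using skew_move[OF Ki_E[of j i] powi_nz] by (simp add: power_int_minus)
  with K_F have "free_tensor (tK i * tF j) (tE i * tKi j) \<approx>\<^bsub>J\<^esub>
      free_tensor (q powi (- r i j) \<odot> (tF j * tK i)) (q powi r j i \<odot> (tKi j * tE i))"
    by (rule tensor_cong)
  also have "\<dots> = free_tensor (tF j * tK i) (tKi j * tE i)"
    using powi_nz[of "r i j"]
    by (simp add: free_tensor_smul_left free_tensor_smul_right r_sym[of j i] power_int_minus)
  finally have 2: "free_tensor (tK i * tF j) (tE i * tKi j) - free_tensor (tF j * tK i) (tKi j * tE i)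
      \<approx>\<^bsub>J\<^esub> 0"
    by (simp add: idcong_def)
  have "\<Delta> (tE i * tF j - tF j * tE i) \<approx>\<^bsub>J\<^esub>
      free_tensor (EF_rhs i j) (tKi j) + free_tensor (tK i) (EF_rhs i j) + 0"
    unfolding 1 by (intro idcong_add J tensor_cong E_F idcong_refl I 2)
  \<comment> \<open>For i = j the mixed term K (x) K^(-1) occurs with both signs, which leaves K (x)
    K - K^(-1) (x) K^(-1).\<close>
  also have "\<dots> = \<Delta> (EF_rhs i j)"
    by (simp add: EF_rhs_def comult_simps free_tensor_smul_left free_tensor_smul_right
        free_tensor_diff_left free_tensor_diff_right flip: smul_add)
  finally show ?thesis .
qed

lemma comult_Serre_E:
  assumes "i \<noteq> j"
  shows "\<Delta> (serre (q ^ d i) (nat (1 - A i j)) (tE i) (tE j)) \<in> J"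
proof -
  let ?s = "serre (q ^ d i) (nat (1 - A i j))"
  let ?x = "free_tensor (tE i) 1" and ?y = "free_tensor (tK i) (tE i)"
    and ?z = "free_tensor (tE j) 1" and ?w = "free_tensor (tK j) (tE j)"
  \<comment> \<open>All three exchange factors arise in the first slot, from moving a K past an E;
    symmetry of the pairing gives \<open>wx\<close> the same exponent as \<open>yz\<close>.\<close>
  have yx: "?y * ?x \<approx>\<^bsub>J\<^esub> (q ^ d i)\<^sup>2 \<odot> (?x * ?y)"
    using tensor_smul_cong_left[OF K_E] by (simp add: free_tensor_mult flip: q_r_diag)
  have yz: "?y * ?z \<approx>\<^bsub>J\<^esub> (q ^ d i) powi A i j \<odot> (?z * ?y)"
    using tensor_smul_cong_left[OF K_E] by (simp add: free_tensor_mult flip: q_r)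
  have wx: "?w * ?x \<approx>\<^bsub>J\<^esub> (q ^ d i) powi A i j \<odot> (?x * ?w)"
    using tensor_smul_cong_left[OF K_E[of j i]] by (simp add: free_tensor_mult r_sym[of j i] flip: q_r)
  have "?s (?x + ?y) (?z + ?w) \<approx>\<^bsub>J\<^esub> ?s ?x ?z + ?s ?y ?w"
    by (rule serre_coproduct[OF J qi_nz qi_nroot int_n[OF assms] yx yz wx])
  moreover have "?s ?x ?z + ?s ?y ?w \<in> J"
    by (intro two_sided_add J serre_tensor_mem Serre_E_mem assms K_comm idcong_refl I)
  ultimately show ?thesis
    unfolding alg_ext_serre alg_ext_gen comult_gen.simps by (rule idcong_mem[OF J])
qed

lemma comult_Serre_F:
  assumes "i \<noteq> j"
  shows "\<Delta> (serre (q ^ d i) (nat (1 - A i j)) (tF i) (tF j)) \<in> J"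
proof -
  let ?s = "serre (q ^ d i) (nat (1 - A i j))"
  \<comment> \<open>For F the second summand of the coproduct takes the role of \<open>x\<close>:
    the positive exponents required by \<open>serre_coproduct\<close> come from moving K^(-1) past F
    in the second slot.\<close>
  let ?x = "free_tensor 1 (tF i)" and ?y = "free_tensor (tF i) (tKi i)"
    and ?z = "free_tensor 1 (tF j)" and ?w = "free_tensor (tF j) (tKi j)"
  have yx: "?y * ?x \<approx>\<^bsub>J\<^esub> (q ^ d i)\<^sup>2 \<odot> (?x * ?y)"
    using tensor_smul_cong_right[OF Ki_F] by (simp add: free_tensor_mult flip: q_r_diag)
  have yz: "?y * ?z \<approx>\<^bsub>J\<^esub> (q ^ d i) powi A i j \<odot> (?z * ?y)"
    using tensor_smul_cong_right[OF Ki_F] by (simp add: free_tensor_mult flip: q_r)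
  have wx: "?w * ?x \<approx>\<^bsub>J\<^esub> (q ^ d i) powi A i j \<odot> (?x * ?w)"
    using tensor_smul_cong_right[OF Ki_F[of j i]] by (simp add: free_tensor_mult r_sym[of j i] flip: q_r)
  have "?s (?x + ?y) (?z + ?w) \<approx>\<^bsub>J\<^esub> ?s ?x ?z + ?s ?y ?w"
    by (rule serre_coproduct[OF J qi_nz qi_nroot int_n[OF assms] yx yz wx])
  moreover have "?s ?x ?z + ?s ?y ?w \<in> J"
    by (intro two_sided_add J serre_tensor_mem Serre_F_mem assms Ki_Ki idcong_refl I)
  ultimately show ?thesis
    unfolding alg_ext_serre alg_ext_gen comult_gen.simps
    by (subst (1 2) add.commute) (rule idcong_mem[OF J])
qed

lemma comult_relations: "x \<in> Uq_relations A d q \<Longrightarrow> \<Delta> x \<in> J"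
proof (induction rule: Uq_relations.induct)
  case (K_Kinv i)
  have "free_tensor (tK i * tKi i) (tK i * tKi i) \<approx>\<^bsub>J\<^esub> free_tensor 1 1"
    by (intro tensor_cong K_Ki)
  then show ?case by (simp add: comult_simps idcong_def)
next
  case (Kinv_K i)
  have "free_tensor (tKi i * tK i) (tKi i * tK i) \<approx>\<^bsub>J\<^esub> free_tensor 1 1"
    by (intro tensor_cong Ki_K)
  then show ?case by (simp add: comult_simps idcong_def)
next
  case (K_K i j)
  have "free_tensor (tK i * tK j) (tK i * tK j) \<approx>\<^bsub>J\<^esub> free_tensor (tK j * tK i) (tK j * tK i)"
    by (intro tensor_cong K_comm)
  then show ?case by (simp add: comult_simps idcong_def)
next
  case (K_E i j)
  have "free_tensor (tK i * tE j * tKi i) (tK i * tKi i) +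
      free_tensor (tK i * tK j * tKi i) (tK i * tE j * tKi i) \<approx>\<^bsub>J\<^esub>
      free_tensor (q powi r i j \<odot> tE j) 1 + free_tensor (tK j) (q powi r i j \<odot> tE j)"
    by (intro idcong_add J tensor_cong K_E_Ki K_x_Ki K_Ki)
  then show ?case
    by (simp add: comult_simps idcong_def algebra_simps free_tensor_smul_left free_tensor_smul_right
        smul_add flip: smul_def)
next
  case (K_F i j)
  have "free_tensor (tK i * tF j * tKi i) (tK i * tKi j * tKi i) +
      free_tensor (tK i * tKi i) (tK i * tF j * tKi i) \<approx>\<^bsub>J\<^esub>
      free_tensor (q powi (- r i j) \<odot> tF j) (tKi j) + free_tensor 1 (q powi (- r i j) \<odot> tF j)"
    by (intro idcong_add J tensor_cong K_F_Ki K_x_Ki K_Ki)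
  then show ?case
    by (simp add: comult_simps idcong_def algebra_simps free_tensor_smul_left free_tensor_smul_right
        smul_add flip: smul_def)
next
  case (E_F i j)
  then show ?case
    using comult_E_F[of i j]
    unfolding idcong_def EF_rhs_def smul_def alg_ext_diff[symmetric] .
next
  case (Serre_E i j)
  then show ?case using comult_Serre_E[of i j] by (simp add: serre_def)
next
  case (Serre_F i j)
  then show ?case using comult_Serre_F[of i j] by (simp add: serre_def)
qed

lemma comult_mem: "x \<in> I \<Longrightarrow> \<Delta> x \<in> J"
proof -
  have "two_sided {x. \<Delta> x \<in> J}"
    using J unfolding two_sided_def by (auto simp: alg_ext_add alg_ext_mult)
  then have "I \<subseteq> {x. \<Delta> x \<in> J}"
    unfolding Uq_ideal_def by (rule Idl_minimal) (auto intro: comult_relations)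
  then show "x \<in> I \<Longrightarrow> \<Delta> x \<in> J" by blast
qed

section \<open>The antipode on the defining relations\<close>

lemma antipode_E_F:
  "\<sigma> (tE i * tF j - tF j * tE i) \<approx>\<^bsub>I\<^esub> \<sigma> (EF_rhs i j)"
proof -
  have "tF j * tK j * (tKi i * tE i) = tF j * (tK j * tKi i) * tE i"
    by (simp add: mult.assoc)
  also have "\<dots> \<approx>\<^bsub>I\<^esub> tF j * (tKi i * tK j) * tE i"
    by (intro idcong_intros I idcong_sym[OF I Ki_K_comm])
  also have "\<dots> = (tF j * tKi i) * (tK j * tE i)"
    by (simp add: mult.assoc)
  also have "\<dots> \<approx>\<^bsub>I\<^esub> (inverse (q powi r i j) \<odot> (tKi i * tF j)) * (q powi r j i \<odot> (tE i * tK j))"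
    by (intro idcong_mult I skew_move[OF Ki_F] powi_nz K_E)
  also have "\<dots> = tKi i * (tF j * tE i) * tK j"
    using powi_nz[of "r i j"] by (simp add: mult.assoc r_sym[of j i])
  finally have 1: "tF j * tK j * (tKi i * tE i) \<approx>\<^bsub>I\<^esub> tKi i * (tF j * tE i) * tK j" .
  have "\<sigma> (tE i * tF j - tF j * tE i) = tF j * tK j * (tKi i * tE i) - tKi i * tE i * (tF j * tK j)"
    by (simp add: antialg_ext_diff antialg_ext_mult)
  also have "\<dots> \<approx>\<^bsub>I\<^esub> tKi i * (tF j * tE i) * tK j - tKi i * tE i * (tF j * tK j)"
    by (intro idcong_diff I idcong_refl 1)
  \<comment> \<open>Moving the K's outwards costs two factors that cancel. Thus S sends the
    commutator of E_i and F_j to minus K_i^(-1) times that commutator times K_j, and the relation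
    applies inside.\<close>
  also have "\<dots> = 0 - tKi i * (tE i * tF j - tF j * tE i) * tK j"
    by (simp add: algebra_simps)
  also have "\<dots> \<approx>\<^bsub>I\<^esub> 0 - tKi i * EF_rhs i j * tK j"
    by (intro idcong_intros I E_F)
  also have "\<dots> \<approx>\<^bsub>I\<^esub> \<sigma> (EF_rhs i j)"
  proof (cases "i = j")
    case True
    let ?c = "1 / (q ^ d i - inverse (q ^ d i))"
    have "0 - tKi i * EF_rhs i j * tK j = ?c \<odot> (tKi i * (tKi i * tK i) - (tKi i * tK i) * tK i)"
      by (simp add: EF_rhs_def True algebra_simps smul_diff smul_uminus_right)
    also have "\<dots> \<approx>\<^bsub>I\<^esub> ?c \<odot> (tKi i * 1 - 1 * tK i)"
      by (intro idcong_intros I Ki_K)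
    also have "\<dots> = \<sigma> (EF_rhs i j)"
      by (simp add: EF_rhs_def True antialg_ext_smul antialg_ext_diff)
    finally show ?thesis .
  qed (simp add: EF_rhs_def idcong_refl[OF I])
  finally show ?thesis .
qed

lemma idcong_uminus: "x \<approx>\<^bsub>I\<^esub> y \<Longrightarrow> - x \<approx>\<^bsub>I\<^esub> - y"
  using idcong_diff[OF I idcong_refl[OF I, of 0]] by fastforce

lemma antipode_Serre_E:
  assumes "i \<noteq> j"
  shows "\<sigma> (serre (q ^ d i) (nat (1 - A i j)) (tE i) (tE j)) \<in> I"
  unfolding antialg_ext_serre antialg_ext_gen antipode_gen.simps
proof (intro two_sided_smul I)
  \<comment> \<open>The sign of the antipode goes into the group-like factor, where it does not
    affect the exchange factors.\<close>
  let ?k = "- tKi i" and ?l = "- tKi j"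
  have skew: "- tKi a * tE b \<approx>\<^bsub>I\<^esub> q powi (- r a b) \<odot> (tE b * (- tKi a))" for a b
    using idcong_uminus[OF Ki_E] by (simp add: smul_uminus_right)
  show "serre (q ^ d i) (nat (1 - A i j)) (- (tKi i * tE i)) (- (tKi j * tE j)) \<in> I"
  proof (rule serre_twist[OF I qi_nz qi_nroot int_n[OF assms] powi_nz powi_nz skew skew])
    show "?l * tE i \<approx>\<^bsub>I\<^esub> q powi (- r i j) \<odot> (tE i * ?l)"
      using skew[of j i] by (simp add: r_sym[of j i])
    show "?k * ?l \<approx>\<^bsub>I\<^esub> ?l * ?k"
      using Ki_Ki by simp
    show "serre (q ^ d i) (nat (1 - A i j)) (tE i) (tE j) \<in> I"
      by (rule Serre_E_mem[OF assms])
  qed (simp_all add: idcong_refl[OF I])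
qed

lemma antipode_Serre_F:
  assumes "i \<noteq> j"
  shows "\<sigma> (serre (q ^ d i) (nat (1 - A i j)) (tF i) (tF j)) \<in> I"
  unfolding antialg_ext_serre antialg_ext_gen antipode_gen.simps
proof (intro two_sided_smul I)
  \<comment> \<open>The antipode puts K to the right of F, whereas \<open>serre_twist\<close> wants
    it on the left; the scalar is the sign together with the price of this exchange.\<close>
  define k where "k a = (- (q powi r a a)) \<odot> tK a" for a
  have skew: "k a * tF b \<approx>\<^bsub>I\<^esub> q powi (- r a b) \<odot> (tF b * k a)" for a b
    using idcong_smul[OF I K_F[of a b], of "- (q powi r a a)"] by (simp add: k_def mult.commute)
  have S: "- (tF a * tK a) \<approx>\<^bsub>I\<^esub> k a * tF a" for a
    using idcong_uminus[OF skew_move[OF K_F[of a a] powi_nz]]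
    by (simp add: k_def power_int_minus smul_uminus_left)
  show "serre (q ^ d i) (nat (1 - A i j)) (- (tF i * tK i)) (- (tF j * tK j)) \<in> I"
  proof (rule serre_twist[OF I qi_nz qi_nroot int_n[OF assms] powi_nz powi_nz skew skew])
    show "k j * tF i \<approx>\<^bsub>I\<^esub> q powi (- r i j) \<odot> (tF i * k j)"
      using skew[of j i] by (simp add: r_sym[of j i])
    show "k i * k j \<approx>\<^bsub>I\<^esub> k j * k i"
      using idcong_smul[OF I K_comm[of i j]] by (simp add: k_def mult.commute)
    show "serre (q ^ d i) (nat (1 - A i j)) (tF i) (tF j) \<in> I"
      by (rule Serre_F_mem[OF assms])
  qed (rule S)+
qed

lemma antipode_relations: "x \<in> Uq_relations A d q \<Longrightarrow> \<sigma> x \<in> I"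
proof (induction rule: Uq_relations.induct)
  case (K_Kinv i)
  then show ?case using K_Ki[of i] by (simp add: antialg_ext_diff antialg_ext_mult idcong_def)
next
  case (Kinv_K i)
  then show ?case using Ki_K[of i] by (simp add: antialg_ext_diff antialg_ext_mult idcong_def)
next
  case (K_K i j)
  then show ?case using Ki_Ki[of j i] by (simp add: antialg_ext_diff antialg_ext_mult idcong_def)
next
  case (K_E i j)
  have "tK i * (- (tKi j * tE j)) * tKi i = - ((tK i * tKi j) * tE j * tKi i)"
    by (simp add: mult.assoc)
  also have "\<dots> \<approx>\<^bsub>I\<^esub> - ((tKi j * tK i) * tE j * tKi i)"
    by (intro idcong_uminus idcong_intros I idcong_sym[OF I Ki_K_comm])
  also have "\<dots> = - (tKi j * (tK i * tE j * tKi i))"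
    by (simp add: mult.assoc)
  also have "\<dots> \<approx>\<^bsub>I\<^esub> - (tKi j * (q powi r i j \<odot> tE j))"
    by (intro idcong_uminus idcong_intros I K_E_Ki)
  finally show ?case
    by (simp add: antialg_ext_diff antialg_ext_mult antialg_ext_smul idcong_def mult.assoc
        smul_uminus_right flip: smul_def)
next
  case (K_F i j)
  have "tK i * (- (tF j * tK j)) * tKi i = - (tK i * tF j * (tK j * tKi i))"
    by (simp add: mult.assoc)
  also have "\<dots> \<approx>\<^bsub>I\<^esub> - (tK i * tF j * (tKi i * tK j))"
    by (intro idcong_uminus idcong_intros I idcong_sym[OF I Ki_K_comm])
  also have "\<dots> = - ((tK i * tF j * tKi i) * tK j)"
    by (simp add: mult.assoc)
  also have "\<dots> \<approx>\<^bsub>I\<^esub> - ((q powi (- r i j) \<odot> tF j) * tK j)"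
    by (intro idcong_uminus idcong_intros I K_F_Ki)
  finally show ?case
    by (simp add: antialg_ext_diff antialg_ext_mult antialg_ext_smul idcong_def mult.assoc
        smul_uminus_right flip: smul_def)
next
  case (E_F i j)
  then show ?case
    using antipode_E_F[of i j]
    unfolding idcong_def EF_rhs_def smul_def antialg_ext_diff[symmetric] .
next
  case (Serre_E i j)
  then show ?case using antipode_Serre_E[of i j] by (simp add: serre_def)
next
  case (Serre_F i j)
  then show ?case using antipode_Serre_F[of i j] by (simp add: serre_def)
qed

lemma antipode_mem: "x \<in> I \<Longrightarrow> \<sigma> x \<in> I"
proof -
  \<comment> \<open>The antihomomorphism interchanges left and right multiples, so the preimage is
    again closed under both.\<close>
  have "two_sided {x. \<sigma> x \<in> I}"
    using I unfolding two_sided_def by (auto simp: antialg_ext_add antialg_ext_mult)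
  then have "I \<subseteq> {x. \<sigma> x \<in> I}"
    unfolding Uq_ideal_def[of A d q]
    by (rule Idl_minimal) (auto intro: antipode_relations[unfolded Uq_ideal_def])
  then show "x \<in> I \<Longrightarrow> \<sigma> x \<in> I" by blast
qed

end


section \<open>The adjoint action on representatives\<close>

abbreviation quot_class :: "'a::ring_1 set \<Rightarrow> 'a \<Rightarrow> 'a set" where
  "quot_class J x \<equiv> J +>\<^bsub>ring_of_type_algebra\<^esub> x"

lemma quot_hom:
  assumes "two_sided J"
  shows "ring_hom_ring ring_of_type_algebra (ring_of_type_algebra Quot J) (quot_class J)"
  using assms ideal.rcos_ring_hom_ring by (auto simp: two_sided_iff_ideal)

lemma quot_carrier: "carrier (ring_of_type_algebra Quot J) = range (quot_class J)"
  by (auto simp: FactRing_def A_RCOSETS_def')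

lemma quot_add: "two_sided J \<Longrightarrow>
    quot_class J x \<oplus>\<^bsub>ring_of_type_algebra Quot J\<^esub> quot_class J y = quot_class J (x + y)"
  and quot_mult: "two_sided J \<Longrightarrow>
    quot_class J x \<otimes>\<^bsub>ring_of_type_algebra Quot J\<^esub> quot_class J y = quot_class J (x * y)"
  and quot_zero: "two_sided J \<Longrightarrow> \<zero>\<^bsub>ring_of_type_algebra Quot J\<^esub> = quot_class J 0"
  and quot_one: "two_sided J \<Longrightarrow> \<one>\<^bsub>ring_of_type_algebra Quot J\<^esub> = quot_class J 1"
proof -
  assume "two_sided J"
  then interpret ring_hom_ring ring_of_type_algebra "ring_of_type_algebra Quot J" "quot_class J"
    by (rule quot_hom)
  show "quot_class J x \<oplus>\<^bsub>ring_of_type_algebra Quot J\<^esub> quot_class J y = quot_class J (x + y)"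
    "quot_class J x \<otimes>\<^bsub>ring_of_type_algebra Quot J\<^esub> quot_class J y = quot_class J (x * y)"
    "\<zero>\<^bsub>ring_of_type_algebra Quot J\<^esub> = quot_class J 0"
    "\<one>\<^bsub>ring_of_type_algebra Quot J\<^esub> = quot_class J 1"
    using hom_add[of x y] hom_mult[of x y] hom_zero hom_one by simp_all
qed

lemma quot_ring: "two_sided J \<Longrightarrow> ring (ring_of_type_algebra Quot J)"
  using quot_hom ring_hom_ring_def by blast

lemma quot_finsum:
  assumes "two_sided J"
  shows "(\<Oplus>\<^bsub>ring_of_type_algebra Quot J\<^esub>m\<in>{..<n}. quot_class J (f m)) = quot_class J (\<Sum>m<(n::nat). f m)"
proof -
  interpret ring "ring_of_type_algebra Quot J" by (rule quot_ring[OF assms])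
  show ?thesis
    by (induction n)
       (simp_all add: quot_zero[OF assms] quot_add[OF assms] quot_carrier lessThan_Suc add.commute)
qed

lemma quot_minus:
  assumes "two_sided J"
  shows "\<ominus>\<^bsub>ring_of_type_algebra Quot J\<^esub> quot_class J x = quot_class J (- x)"
proof -
  interpret ring "ring_of_type_algebra Quot J" by (rule quot_ring[OF assms])
  show ?thesis
    by (rule minus_equality) (simp_all add: quot_zero[OF assms] quot_add[OF assms] quot_carrier)
qed

lemma quot_rep: "two_sided J \<Longrightarrow> y \<in> quot_class J x \<longleftrightarrow> y \<approx>\<^bsub>J\<^esub> x"
  by (force simp: a_r_coset_def r_coset_def idcong_def ring_of_type_algebra_def)

text \<open>Evaluates the unions over representatives by which the Hopf maps are defined: for a map
  that respects the congruences, all members of the union are one and the same coset.\<close>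

lemma UN_quot_class:
  assumes J: "two_sided J" and "two_sided J'" and f: "\<And>y. y \<approx>\<^bsub>J\<^esub> x \<Longrightarrow> f y \<approx>\<^bsub>J'\<^esub> f x"
  shows "(\<Union>y\<in>quot_class J x. quot_class J' (f y)) = quot_class J' (f x)"
proof -
  have "quot_class J' (f y) = quot_class J' (f x)" if "y \<in> quot_class J x" for y
    using that assms by (simp add: quot_rep coset_eq_iff)
  moreover have "x \<in> quot_class J x"
    using J by (simp add: quot_rep idcong_refl)
  ultimately show ?thesis by blast
qed

section \<open>Sums of elementary tensors and the map x (x) y -> x b S(y)\<close>

lemma free_tensor_induct [case_names tensor add]:
  assumes t: "\<And>p s. P (free_tensor p s)" and a: "\<And>t t'. P t \<Longrightarrow> P t' \<Longrightarrow> P (t + t')"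
  shows "P (t :: ('i, 'k::field) free_alg2)"
proof (induction t rule: poly_mapping_single_induct)
  case (single m c)
  have "Poly_Mapping.single m c =
      free_tensor (Poly_Mapping.single (fst m) c) (Poly_Mapping.single (snd m) 1)"
    by (simp add: free_tensor_single)
  then show ?case using t by metis
qed (rule a)

text \<open>Provides the indexed form demanded by the definite description in \<open>ad_L\<close>,
  and so its existence half. Two such sums are joined by concatenating their index ranges.\<close>

lemma free_tensor_sum_ex: "\<exists>(n::nat) x y. t = (\<Sum>m<n. free_tensor (x m) (y m))"
proof (induction t rule: free_tensor_induct)
  case (tensor p s)
  show ?case by (intro exI[of _ 1] exI[of _ "\<lambda>_. p"] exI[of _ "\<lambda>_. s"]) simp
next
  case (add t t')
  from add(1) obtain n :: nat and x y where t: "t = (\<Sum>m<n. free_tensor (x m) (y m))"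
    by blast
  from add(2) obtain n' :: nat and x' y' where t': "t' = (\<Sum>m<n'. free_tensor (x' m) (y' m))"
    by blast
  define x'' where "x'' m = (if m < n then x m else x' (m - n))" for m
  define y'' where "y'' m = (if m < n then y m else y' (m - n))" for m
  have "(\<Sum>m<n + n'. free_tensor (x'' m) (y'' m)) =
      (\<Sum>m<n. free_tensor (x'' m) (y'' m)) + (\<Sum>m=n..<n + n'. free_tensor (x'' m) (y'' m))"
    by (simp add: lessThan_atLeast0 sum.atLeastLessThan_concat)
  also have "(\<Sum>m=n..<n + n'. free_tensor (x'' m) (y'' m)) = t'"
    using sum.shift_bounds_nat_ivl[of "\<lambda>m. free_tensor (x'' m) (y'' m)" 0 n n']
    by (simp add: t' x''_def y''_def add.commute lessThan_atLeast0)
  also have "(\<Sum>m<n. free_tensor (x'' m) (y'' m)) = t"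
    by (simp add: t x''_def y''_def)
  finally show ?case by metis
qed

text \<open>Being linear on T (x) T by construction, it cannot depend on how a tensor is written as
  a sum; only the passage to the quotient is left to check.\<close>

definition sandwich :: "('i, 'k) free_alg \<Rightarrow> ('i, 'k::field) free_alg2 \<Rightarrow> ('i, 'k) free_alg" where
  "sandwich b = lin_ext (\<lambda>(u, v).
     Poly_Mapping.single u 1 * b * antialg_ext antipode_gen (Poly_Mapping.single v 1))"

lemma sandwich_add: "sandwich b (t + t') = sandwich b t + sandwich b t'"
  and sandwich_smul: "sandwich b (c \<odot> t) = c \<odot> sandwich b t"
  and sandwich_uminus: "sandwich b (- t) = - sandwich b t"
  and sandwich_diff: "sandwich b (t - t') = sandwich b t - sandwich b t'"
  and sandwich_sum: "sandwich b (sum g B) = (\<Sum>i\<in>B. sandwich b (g i))"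
  by (simp_all add: sandwich_def lin_ext_add lin_ext_smul lin_ext_diff lin_ext_uminus lin_ext_sum)

lemma sandwich_tensor: "sandwich b (free_tensor p s) = p * b * antialg_ext antipode_gen s"
proof (induction p rule: poly_mapping_single_induct)
  case (single u c)
  show ?case
  proof (induction s rule: poly_mapping_single_induct)
    case (single v e)
    have u: "Poly_Mapping.single u c = c \<odot> Poly_Mapping.single u 1"
      by (simp add: smul_single)
    have v: "Poly_Mapping.single v e = e \<odot> Poly_Mapping.single v 1"
      by (simp add: smul_single)
    have "sandwich b (free_tensor (Poly_Mapping.single u c) (Poly_Mapping.single v e)) =
        (c * e) \<odot> (Poly_Mapping.single u 1 * b * antialg_ext antipode_gen (Poly_Mapping.single v 1))"
      by (simp add: free_tensor_single sandwich_def)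
    then show ?case
      unfolding u v by (simp add: antialg_ext_smul mult.commute)
  qed (simp add: free_tensor_add_right sandwich_add antialg_ext_add algebra_simps)
qed (simp add: free_tensor_add_left sandwich_add algebra_simps)

lemma sandwich_add_left: "sandwich (b + b') t = sandwich b t + sandwich b' t"
  by (induction t rule: free_tensor_induct) (simp_all add: sandwich_tensor sandwich_add algebra_simps)

text \<open>On elementary tensors p p' b S(s s') = p (p' b S(s')) S(s), by antimultiplicativity of
  S. So T (x) T acts on T, and pulling back along \<Delta> gives the action law for
  \<open>ad_L\<close>.\<close>

lemma sandwich_mult: "sandwich b (t * t') = sandwich (sandwich b t') t"
proof (induction t rule: free_tensor_induct)
  case (tensor p s)
  show ?case
    by (induction t' rule: free_tensor_induct)
       (simp_all add: free_tensor_mult sandwich_tensor sandwich_add sandwich_add_left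
          antialg_ext_mult algebra_simps)
qed (simp add: sandwich_add algebra_simps)

lemma sandwich_1 [simp]: "sandwich b 1 = b"
  using sandwich_tensor[of b 1 1] by simp

section \<open>Descent of the Hopf maps and of the action to classes\<close>

context quantized
begin

abbreviation U where "U \<equiv> Uq A d q"
abbreviation cls where "cls \<equiv> Uq_class A d q"

lemma cls_def: "cls x = quot_class I x"
  by (simp add: Uq_class_def)

lemma U_ring: "ring U"
  unfolding Uq_def by (rule quot_ring[OF I])

lemma U_simps:
  "carrier U = range cls" "cls x \<oplus>\<^bsub>U\<^esub> cls y = cls (x + y)" "cls x \<otimes>\<^bsub>U\<^esub> cls y = cls (x * y)"
  "\<one>\<^bsub>U\<^esub> = cls 1" "\<zero>\<^bsub>U\<^esub> = cls 0" "\<ominus>\<^bsub>U\<^esub> cls x = cls (- x)"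
  unfolding Uq_def cls_def
  by (simp_all add: quot_carrier quot_add quot_mult quot_one quot_zero quot_minus I cls_def)

lemma cls_eq_iff: "cls x = cls y \<longleftrightarrow> x \<approx>\<^bsub>I\<^esub> y"
  unfolding cls_def by (rule coset_eq_iff[OF I])

lemma comult_cls: "Uq_comult A d q (cls p) = quot_class J (\<Delta> p)"
  unfolding Uq_comult_def cls_def
  by (rule UN_quot_class[OF I J]) (simp add: idcong_def comult_mem flip: alg_ext_diff)

lemma antipode_cls: "Uq_antipode A d q (cls p) = cls (\<sigma> p)"
  unfolding Uq_antipode_def cls_def
  by (rule UN_quot_class[OF I I]) (simp add: idcong_def antipode_mem flip: antialg_ext_diff)

lemma tensor_cls: "Uq_tensor A d q (cls p) (cls s) = quot_class J (free_tensor p s)"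
proof -
  have "(\<Union>s'\<in>cls s. quot_class J (free_tensor p' s')) = quot_class J (free_tensor p' s)" for p'
    unfolding cls_def by (rule UN_quot_class[OF I J]) (intro tensor_cong idcong_refl I)
  moreover have "(\<Union>p'\<in>cls p. quot_class J (free_tensor p' s)) = quot_class J (free_tensor p s)"
    unfolding cls_def by (rule UN_quot_class[OF I J]) (intro tensor_cong idcong_refl I)
  ultimately show ?thesis unfolding Uq_tensor_def by simp
qed

lemma sandwich_mem_left: "b \<in> I \<Longrightarrow> sandwich b t \<in> I"
  by (induction t rule: free_tensor_induct)
     (auto simp: sandwich_tensor sandwich_add
       intro: two_sided_add[OF I] two_sided_mult_left[OF I] two_sided_mult_right[OF I])

text \<open>Quantifying over the outer factors \<open>x\<close>, \<open>y\<close> turns the kernel condition into an ideal.\<close>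

lemma sandwich_mem_right:
  assumes "t \<in> J"
  shows "sandwich b t \<in> I"
proof -
  let ?N = "{t. \<forall>b x y. sandwich b (x * t * y) \<in> I}"
  have "two_sided ?N"
    unfolding two_sided_def
  proof (intro conjI ballI allI)
    show "0 \<in> ?N"
      using I by (simp add: sandwich_def two_sided_def)
    show "s + t \<in> ?N" if "s \<in> ?N" "t \<in> ?N" for s t
      using that by (simp add: algebra_simps sandwich_add two_sided_add[OF I])
    show "z * t \<in> ?N" "t * z \<in> ?N" if t: "t \<in> ?N" for t z
    proof -
      have "sandwich b (x * (z * t) * y) \<in> I" for b x y
        using t[simplified, rule_format, of b "x * z" y] by (simp add: mult.assoc)
      then show "z * t \<in> ?N" by simp
      have "sandwich b (x * (t * z) * y) \<in> I" for b x y
        using t[simplified, rule_format, of b x "z * y"] by (simp add: mult.assoc)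
      then show "t * z \<in> ?N" by simp
    qed
  qed
  moreover have "free_tensor p 1 \<in> ?N" if p: "p \<in> I" for p
  proof -
    have "sandwich b (x * free_tensor p 1 * y) \<in> I" for b x y
      \<comment> \<open>The product acts by composition: \<open>y\<close> acts first, the generator
        then brings the result into the ideal, and \<open>x\<close> keeps it there.\<close>
      unfolding sandwich_mult
    proof (induction x rule: free_tensor_induct)
      case (tensor u v)
      show ?case
        by (simp add: sandwich_tensor p I two_sided_mult_left two_sided_mult_right)
    next
      case (add x x')
      then show ?case by (simp add: algebra_simps sandwich_add two_sided_add[OF I])
    qed
    then show ?thesis by simp
  qed
  moreover have "free_tensor 1 p \<in> ?N" if p: "p \<in> I" for p
  proof -
    have "sandwich b (x * free_tensor 1 p * y) \<in> I" for b x y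
      unfolding sandwich_mult
      by (rule sandwich_mem_left)
         (simp add: sandwich_tensor antipode_mem p I two_sided_mult_left)
    then show ?thesis by simp
  qed
  ultimately have "J \<subseteq> ?N"
    unfolding Uq2_ideal_def by (intro Idl_minimal) blast+
  then have "sandwich b (1 * t * 1) \<in> I" using assms by blast
  then show ?thesis by simp
qed

text \<open>Uniqueness in the description holds because two expressions for one coproduct have
  representatives differing by an element of \<open>J\<close>, which
  \<open>sandwich_mem_right\<close> sends into \<open>I\<close>.\<close>

lemma ad_L_cls: "ad_L A d q (cls a) (cls b) = cls (sandwich b (\<Delta> a))"
  unfolding ad_L_def
proof (rule the_equality)
  have sum: "(\<Oplus>\<^bsub>U\<^esub>m\<in>{..<n}. cls (f m)) = cls (\<Sum>m<(n::nat). f m)" for n f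
    unfolding Uq_def cls_def by (rule quot_finsum[OF I])
  have sum2: "(\<Oplus>\<^bsub>Uq2 A d q\<^esub>m\<in>{..<n}. quot_class J (f m)) = quot_class J (\<Sum>m<(n::nat). f m)" for n f
    unfolding Uq2_def by (rule quot_finsum[OF J])
  obtain n :: nat and x y where t: "\<Delta> a = (\<Sum>m<n. free_tensor (x m) (y m))"
    using free_tensor_sum_ex by blast
  show "\<exists>(n::nat) x y. x \<in> {..<n} \<rightarrow> carrier U \<and> y \<in> {..<n} \<rightarrow> carrier U \<and>
      Uq_comult A d q (cls a) = (\<Oplus>\<^bsub>Uq2 A d q\<^esub>m\<in>{..<n}. Uq_tensor A d q (x m) (y m)) \<and>
      cls (sandwich b (\<Delta> a)) =
        (\<Oplus>\<^bsub>U\<^esub>m\<in>{..<n}. x m \<otimes>\<^bsub>U\<^esub> cls b \<otimes>\<^bsub>U\<^esub> Uq_antipode A d q (y m))"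
    by (intro exI[of _ n] exI[of _ "\<lambda>m. cls (x m)"] exI[of _ "\<lambda>m. cls (y m)"])
       (simp add: U_simps(1,3) comult_cls tensor_cls antipode_cls sum sum2 t sandwich_sum sandwich_tensor)
  fix z
  assume "\<exists>(n::nat) x y. x \<in> {..<n} \<rightarrow> carrier U \<and> y \<in> {..<n} \<rightarrow> carrier U \<and>
      Uq_comult A d q (cls a) = (\<Oplus>\<^bsub>Uq2 A d q\<^esub>m\<in>{..<n}. Uq_tensor A d q (x m) (y m)) \<and>
      z = (\<Oplus>\<^bsub>U\<^esub>m\<in>{..<n}. x m \<otimes>\<^bsub>U\<^esub> cls b \<otimes>\<^bsub>U\<^esub> Uq_antipode A d q (y m))"
  then obtain n :: nat and x y where x: "x \<in> {..<n} \<rightarrow> carrier U" and y: "y \<in> {..<n} \<rightarrow> carrier U"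
    and eq: "Uq_comult A d q (cls a) = (\<Oplus>\<^bsub>Uq2 A d q\<^esub>m\<in>{..<n}. Uq_tensor A d q (x m) (y m))"
    and z: "z = (\<Oplus>\<^bsub>U\<^esub>m\<in>{..<n}. x m \<otimes>\<^bsub>U\<^esub> cls b \<otimes>\<^bsub>U\<^esub> Uq_antipode A d q (y m))"
    by blast
  \<comment> \<open>Meaningful for m < n only; outside this range the families \<open>x\<close> and
    \<open>y\<close> are unconstrained.\<close>
  define p where "p m = (SOME u. x m = cls u)" for m
  define s where "s m = (SOME u. y m = cls u)" for m
  have p: "x m = cls (p m)" and s: "y m = cls (s m)" if "m < n" for m
  proof -
    have "x m \<in> range cls" "y m \<in> range cls"
      using x y that by (simp_all only: U_simps(1) Pi_iff lessThan_iff)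
    then have "\<exists>u. x m = cls u" "\<exists>u. y m = cls u"
      by blast+
    then show "x m = cls (p m)" "y m = cls (s m)"
      unfolding p_def s_def by - (rule someI_ex, assumption)+
  qed
  interpret U: ring U by (rule U_ring)
  interpret U2: ring "Uq2 A d q" unfolding Uq2_def by (rule quot_ring[OF J])
  have "quot_class J (\<Delta> a) = quot_class J (\<Sum>m<n. free_tensor (p m) (s m))"
  proof -
    have "(\<Oplus>\<^bsub>Uq2 A d q\<^esub>m\<in>{..<n}. Uq_tensor A d q (x m) (y m)) =
        (\<Oplus>\<^bsub>Uq2 A d q\<^esub>m\<in>{..<n}. quot_class J (free_tensor (p m) (s m)))"
      by (rule U2.finsum_cong') (auto simp: p s tensor_cls Uq2_def quot_carrier)
    then show ?thesis using eq by (simp add: comult_cls sum2)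
  qed
  then have "\<Delta> a - (\<Sum>m<n. free_tensor (p m) (s m)) \<in> J"
    by (simp add: coset_eq_iff[OF J] idcong_def)
  from sandwich_mem_right[OF this, of b]
  have "sandwich b (\<Delta> a) \<approx>\<^bsub>I\<^esub> (\<Sum>m<n. p m * b * \<sigma> (s m))"
    by (simp add: idcong_def sandwich_diff sandwich_sum sandwich_tensor)
  moreover have "z = cls (\<Sum>m<n. p m * b * \<sigma> (s m))"
    unfolding z sum[symmetric]
    by (rule U.finsum_cong') (auto simp: p s antipode_cls U_simps)
  ultimately show "z = cls (sandwich b (\<Delta> a))"
    by (simp add: cls_eq_iff idcong_sym[OF I])
qed

section \<open>Orbits of the quantum Levi subalgebra\<close>

abbreviation ad where "ad \<equiv> ad_L A d q"

lemma ad_closed: "a \<in> carrier U \<Longrightarrow> b \<in> carrier U \<Longrightarrow> ad a b \<in> carrier U"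
  by (auto simp: U_simps ad_L_cls)

lemma ad_add: "a \<in> carrier U \<Longrightarrow> a' \<in> carrier U \<Longrightarrow> b \<in> carrier U \<Longrightarrow>
    ad (a \<oplus>\<^bsub>U\<^esub> a') b = ad a b \<oplus>\<^bsub>U\<^esub> ad a' b"
  by (auto simp: U_simps ad_L_cls alg_ext_add sandwich_add)

lemma ad_uminus: "a \<in> carrier U \<Longrightarrow> b \<in> carrier U \<Longrightarrow> ad (\<ominus>\<^bsub>U\<^esub> a) b = \<ominus>\<^bsub>U\<^esub> ad a b"
  by (auto simp: U_simps ad_L_cls alg_ext_uminus sandwich_uminus)

lemma ad_mult: "a \<in> carrier U \<Longrightarrow> a' \<in> carrier U \<Longrightarrow> b \<in> carrier U \<Longrightarrow>
    ad (a \<otimes>\<^bsub>U\<^esub> a') b = ad a (ad a' b)"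
  by (auto simp: U_simps ad_L_cls alg_ext_mult sandwich_mult)

lemma ad_one: "b \<in> carrier U \<Longrightarrow> ad \<one>\<^bsub>U\<^esub> b = b"
  by (auto simp: U_simps ad_L_cls)

lemma ad_scalar: "k \<in> Uq_field A d q \<Longrightarrow> a \<in> carrier U \<Longrightarrow> b \<in> carrier U \<Longrightarrow>
    ad (k \<otimes>\<^bsub>U\<^esub> a) b = k \<otimes>\<^bsub>U\<^esub> ad a b"
  by (auto simp: U_simps ad_L_cls Uq_field_def alg_ext_smul sandwich_smul simp flip: smul_def)

lemma Uq_field_subset: "Uq_field A d q \<subseteq> carrier U"
  by (auto simp: Uq_field_def U_simps)

text \<open>\<open>Uq_levi\<close> is an intersection of Hopf subalgebras. Having the whole algebra
  among them ensures that the intersection lies inside the carrier, where the laws of the action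
  hold.\<close>

lemma hopf_carrier: "Uq_hopf_subalgebra A d q (carrier U)"
proof -
  interpret U: ring U by (rule U_ring)
  have "quot_class J t \<in> generate (add_monoid (Uq2 A d q))
      {Uq_tensor A d q y z | y z. y \<in> carrier U \<and> z \<in> carrier U}" for t
  proof (induction t rule: free_tensor_induct)
    case (tensor p s)
    then show ?case
      by (intro generate.incl) (auto simp: U_simps simp flip: tensor_cls)
  next
    case (add t t')
    then show ?case
      using generate.eng[OF add] by (simp add: Uq2_def quot_add[OF J])
  qed
  then show ?thesis
    unfolding Uq_hopf_subalgebra_def
    using U.carrier_is_subring U.carrier_is_subalgebra[OF Uq_field_subset]
    by (auto simp: U_simps(1) comult_cls antipode_cls)
qed

context
  fixes S :: "'i set"
begin

abbreviation L where "L \<equiv> Uq_levi A d q S"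
abbreviation orbit where "orbit \<equiv> ad_orbit A d q S"

lemma levi_subset: "L \<subseteq> carrier U"
  unfolding Uq_levi_def using hopf_carrier by (auto simp: U_simps(1))

lemma levi_closed:
  "\<one>\<^bsub>U\<^esub> \<in> L"
  "a \<in> L \<Longrightarrow> a' \<in> L \<Longrightarrow> a \<oplus>\<^bsub>U\<^esub> a' \<in> L"
  "a \<in> L \<Longrightarrow> a' \<in> L \<Longrightarrow> a \<otimes>\<^bsub>U\<^esub> a' \<in> L"
  "a \<in> L \<Longrightarrow> \<ominus>\<^bsub>U\<^esub> a \<in> L"
  "k \<in> Uq_field A d q \<Longrightarrow> a \<in> L \<Longrightarrow> k \<otimes>\<^bsub>U\<^esub> a \<in> L"
  unfolding Uq_levi_def Uq_hopf_subalgebra_def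
  using subringE(3,5-7)[of _ U] subalgebra.smult_closed[of "Uq_field A d q" _ U]
  by auto

lemma orbit_self: "v \<in> carrier U \<Longrightarrow> v \<in> orbit v"
  unfolding ad_orbit_def using ad_one[of v] levi_closed(1) by force

lemma orbit_subset: "v \<in> carrier U \<Longrightarrow> orbit v \<subseteq> carrier U"
  unfolding ad_orbit_def using levi_subset ad_closed by blast

lemma orbit_ad_closed: "v \<in> carrier U \<Longrightarrow> a \<in> L \<Longrightarrow> x \<in> orbit v \<Longrightarrow> ad a x \<in> orbit v"
  unfolding ad_orbit_def using levi_subset levi_closed(3) ad_mult by (smt (verit) mem_Collect_eq subsetD)

lemma orbit_subalgebra:
  assumes v: "v \<in> carrier U"
  shows "subalgebra (Uq_field A d q) (orbit v) U"
proof -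
  interpret U: ring U by (rule U_ring)
  have "subgroup (orbit v) (add_monoid U)"
  proof (rule U.add.subgroupI)
    show "orbit v \<subseteq> carrier U" "orbit v \<noteq> {}"
      using orbit_subset[OF v] orbit_self[OF v] by auto
    show "\<ominus>\<^bsub>U\<^esub> x \<in> orbit v" if "x \<in> orbit v" for x
      using that v levi_subset levi_closed(4) ad_uminus unfolding ad_orbit_def
      by (smt (verit) mem_Collect_eq subsetD)
    show "x \<oplus>\<^bsub>U\<^esub> y \<in> orbit v" if "x \<in> orbit v" "y \<in> orbit v" for x y
      using that v levi_subset levi_closed(2) ad_add unfolding ad_orbit_def
      by (smt (verit) mem_Collect_eq subsetD)
  qed
  moreover have "k \<otimes>\<^bsub>U\<^esub> x \<in> orbit v" if "k \<in> Uq_field A d q" "x \<in> orbit v" for k x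
    using that v levi_subset levi_closed(5) ad_scalar unfolding ad_orbit_def
    by (smt (verit) mem_Collect_eq subsetD)
  ultimately show ?thesis
    by (simp add: subalgebra_def subalgebra_axioms_def)
qed

lemma orbit_submodule:
  assumes "v \<in> carrier U" "orbit v \<subseteq> M"
  shows "levi_submodule A d q S (orbit v) M"
  unfolding levi_submodule_def using assms orbit_subalgebra orbit_ad_closed by blast

lemma orbit_least: "levi_submodule A d q S N M \<Longrightarrow> x \<in> N \<Longrightarrow> orbit x \<subseteq> N"
  unfolding levi_submodule_def ad_orbit_def by blast

lemma field_subfield:
  assumes "\<one>\<^bsub>U\<^esub> \<noteq> \<zero>\<^bsub>U\<^esub>"
  shows "subfield (Uq_field A d q) U"
proof -
  let ?k = "ring_of_type_algebra :: 'k ring"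
  interpret k: Ring.field ?k by (rule field_from_type_algebra)
  interpret U: ring U by (rule U_ring)
  have "(\<lambda>c. cls (scal c)) \<in> ring_hom ?k U"
    by (rule ring_hom_memI) (simp_all add: U_simps scal_add scal_mult)
  then have "ring_hom_ring ?k U (\<lambda>c. cls (scal c))"
    by (intro ring_hom_ringI2 k.ring_axioms U.ring_axioms)
  from ring_hom_ring.img_is_subfield(2)[OF this k.carrier_is_subfield assms]
  show ?thesis by (simp add: Uq_field_def)
qed

text \<open>Passing finite dimension to a subspace needs the scalars to form a subfield, hence 1 to
  differ from 0. The nonzero \<open>x\<close> supplies this, without a separate proof that the
  presentation does not collapse.\<close>

lemma locally_finite_orbit_mem:
  assumes w: "w \<in> locally_finite_part A d q S" and x: "x \<in> orbit w" and nz: "x \<noteq> \<zero>\<^bsub>U\<^esub>"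
  shows "x \<in> locally_finite_part A d q S"
proof -
  interpret U: ring U by (rule U_ring)
  have wc: "w \<in> carrier U" and fin: "U.finite_dimension (Uq_field A d q) (orbit w)"
    using w by (auto simp: locally_finite_part_def)
  have xc: "x \<in> carrier U" using x orbit_subset[OF wc] by blast
  have "\<one>\<^bsub>U\<^esub> \<noteq> \<zero>\<^bsub>U\<^esub>"
    using U.l_one[OF xc] U.l_null[OF xc] nz by metis
  from U.subalbegra_incl_imp_finite_dimension[OF field_subfield[OF this] fin orbit_subalgebra[OF xc]]
  show ?thesis
    using orbit_least[OF orbit_submodule[OF wc order_refl] x] xc
    by (simp add: locally_finite_part_def)
qed

lemma minimal_iff_irreducible:
  assumes v: "v \<in> locally_finite_part A d q S"
  shows "minimal_nonzero A d q (orbit_interval A d q S v) =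
    {N. levi_submodule A d q S N (orbit v) \<and> levi_irreducible A d q S N \<and>
        (\<exists>w\<in>locally_finite_part A d q S. N = orbit w)}"
    (is "?L = ?R")
proof (intro Set.set_eqI iffI)
  interpret U: ring U by (rule U_ring)
  have carrier: "w \<in> carrier U" if "w \<in> locally_finite_part A d q S" for w
    using that by (simp add: locally_finite_part_def)
  fix N
  {
    assume "N \<in> ?L"
    then have Nv: "N \<in> orbit_interval A d q S v" and nz: "N \<noteq> {\<zero>\<^bsub>U\<^esub>}"
      and least: "\<And>N'. N' \<in> orbit_interval A d q S v \<Longrightarrow> N' \<noteq> {\<zero>\<^bsub>U\<^esub>} \<Longrightarrow> N' \<subseteq> N \<Longrightarrow> N' = N"
      by (simp_all add: minimal_nonzero_def)
    from Nv obtain w where w: "w \<in> locally_finite_part A d q S" and N: "N = orbit w"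
      and sub: "orbit w \<subseteq> orbit v"
      by (auto simp: orbit_interval_def orbit_poset_def)
    have min: "orbit x = orbit w" if "x \<in> locally_finite_part A d q S" "x \<noteq> \<zero>\<^bsub>U\<^esub>" "orbit x \<subseteq> orbit w" for x
    proof -
      have "orbit x \<in> orbit_interval A d q S v"
        using that sub by (simp add: orbit_interval_def orbit_poset_def)
      moreover have "orbit x \<noteq> {\<zero>\<^bsub>U\<^esub>}"
        using orbit_self[OF carrier[OF that(1)]] that(2) by auto
      ultimately show ?thesis using least[of "orbit x"] that(3) N by simp
    qed
    have "N' = {\<zero>\<^bsub>U\<^esub>} \<or> N' = orbit w" if N': "levi_submodule A d q S N' (orbit w)" for N'
    proof (cases "N' = {\<zero>\<^bsub>U\<^esub>}")
      case False
      have "subalgebra (Uq_field A d q) N' U" and N'w: "N' \<subseteq> orbit w"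
        using N' by (auto simp: levi_submodule_def)
      \<comment> \<open>\<open>N'\<close> being different from the zero submodule yields a nonzero
        element only once \<open>N'\<close> is known to be nonempty.\<close>
      then have "\<zero>\<^bsub>U\<^esub> \<in> N'"
        using subgroup.one_closed[OF subalgebra.axioms(1)] by fastforce
      with False obtain x where x: "x \<in> N'" "x \<noteq> \<zero>\<^bsub>U\<^esub>" by blast
      then have fx: "x \<in> locally_finite_part A d q S"
        using locally_finite_orbit_mem[OF w] N'w by blast
      have "orbit x \<subseteq> N'" by (rule orbit_least[OF N' x(1)])
      moreover have "orbit x = orbit w"
        using min[OF fx x(2)] \<open>orbit x \<subseteq> N'\<close> N'w by simp
      ultimately show ?thesis using N'w by blast
    qed simp
    then have "levi_irreducible A d q S (orbit w)"
      unfolding levi_irreducible_def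
      using orbit_submodule[OF carrier[OF w] orbit_subset[OF carrier[OF w]]] nz N by simp
    then show "N \<in> ?R"
      using orbit_submodule[OF carrier[OF w] sub] w N by auto
  next
    assume "N \<in> ?R"
    then obtain w where w: "w \<in> locally_finite_part A d q S" and N: "N = orbit w"
      and sub: "orbit w \<subseteq> orbit v" and irr: "levi_irreducible A d q S (orbit w)"
      by (auto simp: levi_submodule_def)
    have "orbit w' = orbit w" if "w' \<in> locally_finite_part A d q S" "orbit w' \<noteq> {\<zero>\<^bsub>U\<^esub>}"
      "orbit w' \<subseteq> orbit w" for w'
      using irr orbit_submodule[OF carrier[OF that(1)] that(3)] that(2)
      unfolding levi_irreducible_def by blast
    moreover have "orbit w \<noteq> {\<zero>\<^bsub>U\<^esub>}"
      using irr unfolding levi_irreducible_def by blast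
    ultimately show "N \<in> ?L"
      using w N sub
      by (auto simp: minimal_nonzero_def orbit_interval_def orbit_poset_def)
  }
qed

end

end

theorem proposition19:
  fixes A :: "'i::finite \<Rightarrow> 'i \<Rightarrow> int" and d :: "'i \<Rightarrow> nat"
    and q :: "'k::field_char_0" and S :: "'i set"
    and v :: "('i, 'k) free_alg set"
  assumes "semisimple_cartan A d"
    and "q \<noteq> 0" and "\<forall>n>0. q ^ n \<noteq> 1"
    and "v \<in> locally_finite_part A d q S"
  shows "minimal_nonzero A d q (orbit_interval A d q S v) =
    {N. levi_submodule A d q S N (ad_orbit A d q S v) \<and> levi_irreducible A d q S N \<and>
        (\<exists>w\<in>locally_finite_part A d q S. N = ad_orbit A d q S w)}"
proof -
  interpret quantized A d q
    by unfold_locales (use assms in auto)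
  show ?thesis by (rule minimal_iff_irreducible[OF assms(4)])
qed

end
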